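(* Let $\mathbf M = \langle Q \cup \Sigma \cup \{0\}; \cdot\rangle$ be a finite automatic algebra. If $\Sigma$ acts as an abelian group of permutations of $Q$ (that is, each $a\in\Sigma$ acts as a permutation $\rho_a$ of $Q$ and $\{\rho_a\mid a\in\Sigma\}$ is an abelian subgroup of the symmetric group on $Q$), then $\mathbf M$ is dualizable.
   Context: **Automatic algebras.** An automatic algebra is an algebra with a single binary operation $\mathbf M = \langle Q \cup \Sigma \cup \{0\}; \cdot\rangle$, where $Q$ (states) and $\Sigma$ (letters) are disjoint sets and $0 \notin Q\cup\Sigma$, that encodes a partial (deterministic) automaton: each letter $a \in \Sigma$ acts as a partial map $Q \to Q$; for $q,r\in Q$ and $a \in \Sigma$ we have $q\cdot a = r$ iff $a$ sends $q$ to $r$; all other products are $0$. **Dualizability.** Let $\mathbf M$ be a finite algebra with universe $M$. A $k$-ary relation on $M$ ($k\ge 1$) is compatible with $\mathbf M$ if it is a subuniverse of $\mathbf M^k$. For $\mathbf A \in \mathbb{ISP}(\mathbf M)$ (isomorphic copies of subalgebras of powers of $\mathbf M$), view $\hom(\mathbf A,\mathbf M)\subseteq M^A$ with the subspace topology of the product topology ($M$ discrete), and with relations on $M$ interpreted pointwise. A map $f\colon \hom(\mathbf A,\mathbf M)\to M$ is an evaluation if there is $a\in A$ with $f(x)=x(a)$ for all $x$. The algebra $\mathbf M$ is dualizable if, for every $\mathbf A\in\mathbb{ISP}(\mathbf M)$, every continuous map $f\colon\hom(\mathbf A,\mathbf M)\to M$ that preserves all finitary compatible relations on $\mathbf M$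 is an evaluation. *)

theory Defs
  imports "HOL-Analysis.Analysis" "HOL-Algebra.Bij"
begin

section \<open>Algebras with one binary operation\<close>

record 'a binar = "'a partial_object" +
  opr :: "'a \<Rightarrow> 'a \<Rightarrow> 'a"

definition subuniverse :: "'a set \<Rightarrow> 'a binar \<Rightarrow> bool" where
  "subuniverse B M \<longleftrightarrow> B \<subseteq> carrier M \<and> (\<forall>x\<in>B. \<forall>y\<in>B. opr M x y \<in> B)"

definition binar_algebra :: "'a binar \<Rightarrow> bool" where
  "binar_algebra M \<longleftrightarrow> (\<forall>x\<in>carrier M. \<forall>y\<in>carrier M. opr M x y \<in> carrier M)"

text \<open>Homomorphisms are taken to be extensional, i.e. undefined outside the domain,
  so that distinct members of \<open>binar_hom A M\<close> differ on \<open>carrier A\<close>.\<close>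

definition binar_hom :: "'b binar \<Rightarrow> 'a binar \<Rightarrow> ('b \<Rightarrow> 'a) set" where
  "binar_hom A M = {x \<in> carrier A \<rightarrow>\<^sub>E carrier M.
     \<forall>a\<in>carrier A. \<forall>b\<in>carrier A. x (opr A a b) = opr M (x a) (x b)}"

definition binar_iso :: "'b binar \<Rightarrow> 'a binar \<Rightarrow> ('b \<Rightarrow> 'a) set" where
  "binar_iso A M = {h \<in> binar_hom A M. bij_betw h (carrier A) (carrier M)}"

definition binar_power :: "'a binar \<Rightarrow> 'i set \<Rightarrow> ('i \<Rightarrow> 'a) binar" where
  "binar_power M I =
     \<lparr>carrier = (I \<rightarrow>\<^sub>E carrier M), opr = (\<lambda>f g. \<lambda>i\<in>I. opr M (f i) (g i))\<rparr>"

text \<open>The index set of the power ranges over all subsets (including the empty one) of the type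
  \<open>'i\<close>.  Empty algebras are not excluded; since the empty relation is compatible,
  they impose no condition on dualizability.\<close>

definition in_ISP :: "'i itself \<Rightarrow> 'b binar \<Rightarrow> 'a binar \<Rightarrow> bool" where
  "in_ISP _ A M \<longleftrightarrow> binar_algebra A \<and>
     (\<exists>(I::'i set) B h. subuniverse B (binar_power M I) \<and>
        h \<in> binar_iso A ((binar_power M I)\<lparr>carrier := B\<rparr>))"

section \<open>Dualizability\<close>

definition compatible_rel :: "'a binar \<Rightarrow> nat \<Rightarrow> (nat \<Rightarrow> 'a) set \<Rightarrow> bool" where
  "compatible_rel M k R \<longleftrightarrow> k \<ge> 1 \<and> subuniverse R (binar_power M {..<k})"

definition hom_topology :: "'b binar \<Rightarrow> 'a binar \<Rightarrow> ('b \<Rightarrow> 'a) topology" where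
  "hom_topology A M =
     subtopology (product_topology (\<lambda>_. discrete_topology (carrier M)) (carrier A))
       (binar_hom A M)"

definition rel_pointwise ::
  "'b binar \<Rightarrow> 'a binar \<Rightarrow> nat \<Rightarrow> (nat \<Rightarrow> 'a) set \<Rightarrow> (nat \<Rightarrow> 'b \<Rightarrow> 'a) set" where
  "rel_pointwise A M k R = {xs \<in> {..<k} \<rightarrow>\<^sub>E binar_hom A M.
     \<forall>a\<in>carrier A. (\<lambda>i\<in>{..<k}. xs i a) \<in> R}"

definition preserves_rel ::
  "'b binar \<Rightarrow> 'a binar \<Rightarrow> nat \<Rightarrow> (nat \<Rightarrow> 'a) set \<Rightarrow> (('b \<Rightarrow> 'a) \<Rightarrow> 'a) \<Rightarrow> bool" where
  "preserves_rel A M k R f \<longleftrightarrow>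
     (\<forall>xs \<in> rel_pointwise A M k R. (\<lambda>i\<in>{..<k}. f (xs i)) \<in> R)"

definition is_evaluation :: "'b binar \<Rightarrow> 'a binar \<Rightarrow> (('b \<Rightarrow> 'a) \<Rightarrow> 'a) \<Rightarrow> bool" where
  "is_evaluation A M f \<longleftrightarrow> (\<exists>a\<in>carrier A. \<forall>x\<in>binar_hom A M. f x = x a)"

text \<open>HOL cannot quantify over types inside a definition, so the type \<open>'b\<close> carrying the
  algebras \<open>A\<close> and the type \<open>'i\<close> carrying the index sets of the powers are parameters.
  Dualizability is this predicate for arbitrary (universally quantified) \<open>'b\<close> and \<open>'i\<close>.\<close>

definition dualizable :: "'b itself \<Rightarrow> 'i itself \<Rightarrow> 'a binar \<Rightarrow> bool" where
  "dualizable _ TI M \<longleftrightarrow>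
     (\<forall>A::'b binar. in_ISP TI A M \<longrightarrow>
        (\<forall>f. continuous_map (hom_topology A M) (discrete_topology (carrier M)) f \<and>
             (\<forall>k R. compatible_rel M k R \<longrightarrow> preserves_rel A M k R f) \<longrightarrow>
             is_evaluation A M f))"

section \<open>Automatic algebras\<close>

text \<open>\<open>\<delta> a\<close> is the partial map \<open>Q \<rightharpoonup> Q\<close> by which the letter \<open>a\<close> acts, and \<open>z\<close> is the element
  written 0 in the algebra.\<close>

definition partial_automaton ::
  "'a set \<Rightarrow> 'a set \<Rightarrow> 'a \<Rightarrow> ('a \<Rightarrow> 'a \<rightharpoonup> 'a) \<Rightarrow> bool" where
  "partial_automaton Q \<Sigma> z \<delta> \<longleftrightarrow>
     Q \<inter> \<Sigma> = {} \<and> z \<notin> Q \<union> \<Sigma> \<and> (\<forall>a\<in>\<Sigma>. dom (\<delta> a) \<subseteq> Q \<and> ran (\<delta> a) \<subseteq> Q)"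

definition automatic_algebra ::
  "'a set \<Rightarrow> 'a set \<Rightarrow> 'a \<Rightarrow> ('a \<Rightarrow> 'a \<rightharpoonup> 'a) \<Rightarrow> 'a binar" where
  "automatic_algebra Q \<Sigma> z \<delta> =
     \<lparr>carrier = Q \<union> \<Sigma> \<union> {z},
      opr = (\<lambda>q a. if q \<in> Q \<and> a \<in> \<Sigma> then (case \<delta> a q of Some r \<Rightarrow> r | None \<Rightarrow> z) else z)\<rparr>"

definition letter_map :: "'a set \<Rightarrow> ('a \<Rightarrow> 'a \<rightharpoonup> 'a) \<Rightarrow> 'a \<Rightarrow> 'a \<Rightarrow> 'a" where
  "letter_map Q \<delta> a = (\<lambda>q\<in>Q. the (\<delta> a q))"

definition acts_as_abelian_permutation_group ::
  "'a set \<Rightarrow> 'a set \<Rightarrow> ('a \<Rightarrow> 'a \<rightharpoonup> 'a) \<Rightarrow> bool" where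
  "acts_as_abelian_permutation_group Q \<Sigma> \<delta> \<longleftrightarrow>
     (\<forall>a\<in>\<Sigma>. dom (\<delta> a) = Q \<and> letter_map Q \<delta> a \<in> Bij Q) \<and>
     subgroup (letter_map Q \<delta> ` \<Sigma>) (BijGroup Q) \<and>
     comm_group ((BijGroup Q)\<lparr>carrier := letter_map Q \<delta> ` \<Sigma>\<rparr>)"

end

theory Submission
  imports Defs "HOL-Algebra.Multiplicative_Group"
begin

text \<open>
  Write \<open>X\<close> for the set of homomorphisms from \<open>A\<close> to \<open>M\<close>, and let \<open>f\<close> be a continuous map on \<open>X\<close>
  that preserves the compatible relations.  Applied to the relation of all value tuples
  \<open>(x\<^sub>1 a, ..., x\<^sub>k a)\<close> with \<open>a\<close> in \<open>A\<close>, preservation says that \<open>f\<close> agrees on every finite set of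
  homomorphisms with the evaluation at some element
  (\<open>preserving_imp_local_evaluation\<close>).  Compactness of \<open>X\<close> gives a finite set \<open>F\<close> of elements
  such that \<open>f x\<close> depends only on the restriction of \<open>x\<close> to \<open>F\<close> (\<open>continuous_finite_support\<close>).
  The task is to find one element that works for all of \<open>X\<close>, and it is done by exhibiting enough
  homomorphisms to corner that element.

  \<^item> \<^emph>\<open>Letters.\<close>  An element that is not a product may be sent to a letter or to 0 freely, as long as
    all products go to 0.  If \<open>f\<close> takes a letter as value on the largest such homomorphism, then
    the indicator of a single element singles out the element at which \<open>f\<close> evaluates
    (\<open>evaluation_at_irreducible\<close>).  Otherwise all the local evaluations can be taken at
    products, and \<open>f\<close> has values in \<open>Q \<union> {0}\<close>.

  \<^item> \<^emph>\<open>Supports.\<close>  Homomorphisms can be cut down to smaller supports.  Cutting with finitely many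
    \<open>x\<close> with \<open>f x \<in> Q\<close> at a time shows that among all these there is one of least support
    (\<open>minimal_hom\<close>).  Its minimality forces its support to consist of the divisors of one element \<open>a\<close> and
    the letters acting invertibly on \<open>a\<close>, whence \<open>f x \<in> Q\<close> iff \<open>x a \<in> Q\<close> (\<open>principal_support\<close>).

  \<^item> \<^emph>\<open>Values.\<close>  On the homomorphisms with \<open>x a \<in> Q\<close>, the local evaluations are at elements \<open>a \<cdot> v\<close>,
    where \<open>v\<close> is a word in the letters that act invertibly on \<open>a\<close>.  These words modulo their effect
    on \<open>a\<close> form an abelian group \<open>H\<close> whose exponent divides the exponent \<open>m\<close> of the group of
    permutations, and \<open>f\<close> is determined by values on a finitely generated, hence finite, subgroup
    \<open>K\<close>.  If the local evaluation were at an element outside of \<open>K\<close>, a character of \<open>H\<close> that is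
    trivial on \<open>K\<close> but not on that element would give a homomorphism that \<open>f\<close> cannot distinguish
    from one whose letters all act trivially, although the evaluation does (\<open>separating_character\<close>).  So the local
    evaluations are at elements of \<open>K\<close>, and as only finitely many restrictions of homomorphisms to
    \<open>K\<close> exist, one element of \<open>K\<close> serves them all (\<open>evaluation_at_word\<close>).
\<close>

section \<open>Characters of commutative monoids with torsion\<close>

lemma repeat_mset_mem:
  assumes "{#} \<in> P" "\<And>V W. V \<in> P \<Longrightarrow> W \<in> P \<Longrightarrow> V + W \<in> P" "V \<in> P"
  shows "repeat_mset k V \<in> P"
  by (induction k) (use assms in auto)

text \<open>Finite cyclic groups \<open>\<int>/m\<close> are injective among abelian groups of exponent dividing \<open>m\<close>.  Here the
  group is the free commutative monoid of multisets modulo the saturated submonoid \<open>P\<close>; the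
  torsion hypothesis provides the inverses.  A character of that quotient is a weight function
  \<open>l\<close>, read modulo \<open>m\<close>.  The character that sends \<open>H\<close>, of order \<open>r\<close> modulo \<open>P\<close>, to \<open>m / r\<close> is
  extended from the multiples of \<open>H\<close> to all multisets by Zorn's lemma.\<close>

lemma exists_character:
  fixes P :: "'b multiset set" and m :: nat
  assumes zero: "{#} \<in> P" and add: "\<And>V W. V \<in> P \<Longrightarrow> W \<in> P \<Longrightarrow> V + W \<in> P"
    and cancel: "\<And>V W. V + W \<in> P \<Longrightarrow> W \<in> P \<Longrightarrow> V \<in> P"
    and torsion: "\<And>V. repeat_mset m V \<in> P" and m: "m > 0" and H: "H \<notin> P"
  shows "\<exists>(l :: 'b \<Rightarrow> nat) n. 0 < n \<and> n < m \<and> (\<forall>V\<in>P. m dvd (\<Sum>c\<in>#V. l c)) \<and>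
           (\<Sum>c\<in>#H. l c) mod m = n"
proof -
  have torsion': "repeat_mset (k * m) V \<in> P" for k V
    using torsion[of "repeat_mset k V"] by (simp add: mult.commute)
  \<comment> \<open>Modulo \<open>m\<close>, the factor \<open>m - 1\<close> is \<open>- 1\<close>, so this reduces a multiple \<open>k\<close> modulo \<open>r\<close>.\<close>
  have step: "V + repeat_mset (k mod r) X \<in> P"
    if "V + repeat_mset (k + (m - 1) * (k div r * r)) X \<in> P" for V k r X
  proof -
    have "k + (m - 1) * (k div r * r) = k mod r + (k div r * r) * m"
      using m div_mult_mod_eq[of k r] by (cases m) (auto simp: algebra_simps)
    with that have "(V + repeat_mset (k mod r) X) + repeat_mset ((k div r * r) * m) X \<in> P"
      by (simp only: repeat_mset_distrib add.assoc)
    with cancel torsion' show ?thesis by blast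
  qed
  \<comment> \<open>The graph of a partial character: a submonoid of pairs in which the elements of \<open>P\<close> are paired
    only with multiples of \<open>m\<close>, which is single-valuedness modulo \<open>P\<close> and \<open>m\<close>.\<close>
  define ok where "ok R \<longleftrightarrow> ({#}, 0) \<in> R \<and>
      (\<forall>V s W t. (V, s) \<in> R \<longrightarrow> (W, t) \<in> R \<longrightarrow> (V + W, s + t) \<in> R) \<and>
      (\<forall>V t. (V, t) \<in> R \<longrightarrow> V \<in> P \<longrightarrow> m dvd t)" for R :: "('b multiset \<times> nat) set"
  define r where "r = (LEAST r. r > 0 \<and> repeat_mset r H \<in> P)"
  have r: "r > 0" "repeat_mset r H \<in> P"
    using LeastI[of "\<lambda>r. r > 0 \<and> repeat_mset r H \<in> P" m] m torsion unfolding r_def by auto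
  have r_le: "r \<le> k" if "k > 0" "repeat_mset k H \<in> P" for k
    unfolding r_def using that by (intro Least_le) auto
  have r_dvd: "r dvd k" if k: "repeat_mset k H \<in> P" for k
  proof -
    have "repeat_mset ((m - 1) * (k div r)) (repeat_mset r H) \<in> P"
      using repeat_mset_mem[OF zero add r(2)] by blast
    with k have "{#} + repeat_mset (k + (m - 1) * (k div r * r)) H \<in> P"
      using add[of "repeat_mset k H"] by (simp only: repeat_mset_right repeat_mset_distrib mult.assoc add_0)
    from step[OF this] have "repeat_mset (k mod r) H \<in> P" by simp
    with r_le[of "k mod r"] r(1) show ?thesis
      by (metis dvd_eq_mod_eq_0 gr0I leD mod_less_divisor)
  qed
  have "r dvd m" using r_dvd torsion by blast
  then obtain n where n: "m = r * n" by (auto simp: dvd_def)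
  have "r \<noteq> 1" using r(2) H by auto
  with n m r have n0: "0 < n" "n < m" by auto
  define R0 where "R0 = {(repeat_mset k H, k * n) | k. True}"
  have R0I: "(repeat_mset k H, k * n) \<in> R0" for k by (auto simp: R0_def)
  have "ok R0"
    unfolding ok_def
  proof (intro conjI allI impI)
    show "({#}, 0) \<in> R0" using R0I[of 0] by simp
    show "(V + W, s + t) \<in> R0" if "(V, s) \<in> R0" "(W, t) \<in> R0" for V s W t
      using that unfolding R0_def by (auto simp flip: repeat_mset_distrib add_mult_distrib)
    show "m dvd t" if "(V, t) \<in> R0" "V \<in> P" for V t
      using that r_dvd unfolding R0_def n by (auto intro: mult_dvd_mono)
  qed
  have "\<exists>R\<in>{R. R0 \<subseteq> R \<and> ok R}. \<forall>R'\<in>{R. R0 \<subseteq> R \<and> ok R}. R \<subseteq> R' \<longrightarrow> R' = R"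
  proof (rule subset_Zorn_nonempty)
    show "{R. R0 \<subseteq> R \<and> ok R} \<noteq> {}" using \<open>ok R0\<close> by auto
    fix \<C> assume ne: "\<C> \<noteq> {}" and ch: "subset.chain {R. R0 \<subseteq> R \<and> ok R} \<C>"
    then have sub: "\<And>R. R \<in> \<C> \<Longrightarrow> R0 \<subseteq> R \<and> ok R"
      and lin: "\<And>R S. R \<in> \<C> \<Longrightarrow> S \<in> \<C> \<Longrightarrow> R \<subseteq> S \<or> S \<subseteq> R"
      by (auto simp: subset_chain_def)
    have "ok (\<Union>\<C>)" unfolding ok_def
    proof (intro conjI allI impI)
      show "({#}, 0) \<in> \<Union>\<C>" using ne sub by (auto simp: ok_def)
      show "(V + W, s + t) \<in> \<Union>\<C>" if VW: "(V, s) \<in> \<Union>\<C>" "(W, t) \<in> \<Union>\<C>" for V s W t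
      proof -
        obtain R S where "R \<in> \<C>" "(V, s) \<in> R" "S \<in> \<C>" "(W, t) \<in> S" using VW by blast
        then obtain T where T: "T \<in> \<C>" "(V, s) \<in> T" "(W, t) \<in> T" using lin[of R S] by blast
        then have "(V + W, s + t) \<in> T" using sub[OF T(1)] unfolding ok_def by blast
        with T show ?thesis by blast
      qed
      show "m dvd t" if "(V, t) \<in> \<Union>\<C>" "V \<in> P" for V t
        using that sub unfolding ok_def by blast
    qed
    then show "\<Union>\<C> \<in> {R. R0 \<subseteq> R \<and> ok R}" using ne sub by blast
  qed
  then obtain R where Rm: "R \<in> {R. R0 \<subseteq> R \<and> ok R}"
    and mx: "\<forall>R'\<in>{R. R0 \<subseteq> R \<and> ok R}. R \<subseteq> R' \<longrightarrow> R' = R" by (rule bexE)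
  from Rm have R: "R0 \<subseteq> R" "ok R" by simp_all
  have max: "R' = R" if "ok R'" "R \<subseteq> R'" for R'
    using mx[rule_format, OF _ that(2)] R(1) that by auto
  have Rz: "({#}, 0) \<in> R" and Rp: "\<And>V s W t. (V, s) \<in> R \<Longrightarrow> (W, t) \<in> R \<Longrightarrow> (V + W, s + t) \<in> R"
    and RP: "\<And>V t. (V, t) \<in> R \<Longrightarrow> V \<in> P \<Longrightarrow> m dvd t"
    using R(2) unfolding ok_def by simp_all
  have Rk: "(repeat_mset k V, k * t) \<in> R" if "(V, t) \<in> R" for k V t
    by (induction k) (use Rz Rp[OF that] in auto)
  have total: "\<exists>s. (X, s) \<in> R" for X
  proof -
    define D where "D k \<longleftrightarrow> (\<exists>V t. (V, t) \<in> R \<and> V + repeat_mset k X \<in> P)" for k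
    define d where "d = (LEAST d. d > 0 \<and> D d)"
    have "D m" unfolding D_def using Rz torsion by (intro exI[of _ "{#}"] exI[of _ 0]) auto
    then have d: "d > 0" "D d"
      using LeastI[of "\<lambda>r. r > 0 \<and> D r" m] m unfolding d_def by auto
    have d_le: "d \<le> k" if "k > 0" "D k" for k
      unfolding d_def using that by (intro Least_le) auto
    obtain V0 t0 where V0: "(V0, t0) \<in> R" "V0 + repeat_mset d X \<in> P" using d unfolding D_def by blast
    have P0: "repeat_mset k V0 + repeat_mset (k * d) X \<in> P" for k
      using repeat_mset_mem[OF zero add V0(2), of k] by simp
    have shift: "(V + repeat_mset ((m - 1) * j) V0) + repeat_mset (k + (m - 1) * (j * d)) X \<in> P"
      if "V + repeat_mset k X \<in> P" for V k j
      using add[OF that P0[of "(m - 1) * j"]] by (simp only: repeat_mset_distrib mult.assoc add_ac)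
    have d_dvd: "d dvd k" if k: "D k" for k
    proof -
      obtain V t where V: "(V, t) \<in> R" "V + repeat_mset k X \<in> P" using k unfolding D_def by blast
      have "(V + repeat_mset ((m - 1) * (k div d)) V0, t + (m - 1) * (k div d) * t0) \<in> R"
        using Rp[OF V(1) Rk[OF V0(1)]] by blast
      with step[OF shift[OF V(2)]] have "D (k mod d)" unfolding D_def by blast
      with d_le[of "k mod d"] d(1) show ?thesis
        by (meson dvd_eq_mod_eq_0 gr0I leD mod_less_divisor)
    qed
    \<comment> \<open>The value \<open>- t0\<close> forced on \<open>d\<close> copies of \<open>X\<close> is divisible by \<open>d\<close>, because \<open>d\<close> divides \<open>m\<close>
      and the \<open>m / d\<close>-fold multiple of it must vanish modulo \<open>m\<close>.  So a value for \<open>X\<close> exists.\<close>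
    obtain e where e: "m = d * e" using d_dvd[OF \<open>D m\<close>] by (auto simp: dvd_def)
    have "repeat_mset e V0 \<in> P"
      using P0[of e] cancel torsion[of X] e by (simp add: mult.commute)
    then have "m dvd e * t0" using RP Rk[OF V0(1)] by blast
    with e m have "d dvd t0" by (auto simp: mult.commute)
    then obtain s0 where s0: "t0 = d * s0" by (auto simp: dvd_def)
    define s where "s = (m - 1) * s0"
    define R' where "R' = {(V + repeat_mset k X, t + k * s) | V t k. (V, t) \<in> R}"
    have R'I: "(V + repeat_mset k X, t + k * s) \<in> R'" if "(V, t) \<in> R" for V t k
      using that by (auto simp: R'_def)
    have "ok R'" unfolding ok_def
    proof (intro conjI allI impI)
      show "({#}, 0) \<in> R'" using R'I[OF Rz, of 0] by simp
      show "(V + W, t + u) \<in> R'" if VW: "(V, t) \<in> R'" "(W, u) \<in> R'" for V t W u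
      proof -
        obtain V1 t1 k W1 u1 l where *: "V = V1 + repeat_mset k X" "t = t1 + k * s" "(V1, t1) \<in> R"
          "W = W1 + repeat_mset l X" "u = u1 + l * s" "(W1, u1) \<in> R"
          using VW unfolding R'_def by blast
        have "V + W = (V1 + W1) + repeat_mset (k + l) X" "t + u = (t1 + u1) + (k + l) * s"
          using * by (auto simp: repeat_mset_distrib add_mult_distrib)
        with R'I[OF Rp[OF *(3,6)], of "k + l"] show ?thesis by simp
      qed
      show "m dvd u" if W: "(W, u) \<in> R'" "W \<in> P" for W u
      proof -
        obtain V t k where *: "W = V + repeat_mset k X" "u = t + k * s" "(V, t) \<in> R"
          using W unfolding R'_def by blast
        then have "D k" using W unfolding D_def by blast
        then obtain j where j: "k = d * j" using d_dvd by (auto simp: dvd_def)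
        have "k + (m - 1) * (j * d) = k * m" using m j by (cases m) (auto simp: algebra_simps)
        then have "V + repeat_mset ((m - 1) * j) V0 \<in> P"
          using shift[of V k j] W(2) cancel torsion'[of k X] unfolding * by (metis (no_types))
        with RP Rp[OF *(3) Rk[OF V0(1)]] have "m dvd t + (m - 1) * j * t0" by blast
        then show ?thesis unfolding * s_def j s0 by (simp add: ac_simps)
      qed
    qed
    moreover have "R \<subseteq> R'" using R'I[of _ _ 0] by auto
    ultimately have "R' = R" by (rule max)
    with R'I[OF Rz, of 1] show ?thesis by auto
  qed
  define l where "l c = (SOME s. ({#c#}, s) \<in> R)" for c
  have lc: "({#c#}, l c) \<in> R" for c unfolding l_def using total by (rule someI_ex)
  have lR: "(V, \<Sum>c\<in>#V. l c) \<in> R" for V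
  proof (induction V)
    case empty then show ?case using Rz by simp
  next
    case (add c V) then show ?case using Rp[OF lc[of c] add] by simp
  qed
  have "m dvd n + (m - 1) * (\<Sum>c\<in>#H. l c)"
  proof (rule RP)
    have "(H, n) \<in> R" using R(1) R0I[of 1] by auto
    from Rp[OF this Rk[OF lR[of H], of "m - 1"]]
    show "(H + repeat_mset (m - 1) H, n + (m - 1) * (\<Sum>c\<in>#H. l c)) \<in> R" .
    show "H + repeat_mset (m - 1) H \<in> P" using torsion[of H] m by (cases m) auto
  qed
  then have "(n + (m - 1) * (\<Sum>c\<in>#H. l c) + (\<Sum>c\<in>#H. l c)) mod m = (\<Sum>c\<in>#H. l c) mod m"
    by auto
  moreover have "n + (m - 1) * (\<Sum>c\<in>#H. l c) + (\<Sum>c\<in>#H. l c) = n + m * (\<Sum>c\<in>#H. l c)"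
    using m by (cases m) auto
  ultimately have "(\<Sum>c\<in>#H. l c) mod m = n" using n0(2) by (metis mod_mult_self2 mod_less)
  then show ?thesis using n0 RP[OF lR] by blast
qed

section \<open>Words acting on the states\<close>

abbreviation act :: "'a binar \<Rightarrow> 'a \<Rightarrow> 'a list \<Rightarrow> 'a" where
  "act B \<equiv> foldl (opr B)"

locale abelian_automaton =
  fixes Q \<Sigma> :: "'a set" and z :: 'a and \<delta> :: "'a \<Rightarrow> 'a \<rightharpoonup> 'a"
  assumes automaton: "partial_automaton Q \<Sigma> z \<delta>"
    and finite_Q: "finite Q" and finite_\<Sigma>: "finite \<Sigma>"
    and abelian: "acts_as_abelian_permutation_group Q \<Sigma> \<delta>"
begin

abbreviation M :: "'a binar" where "M \<equiv> automatic_algebra Q \<Sigma> z \<delta>"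
abbreviation mul :: "'a \<Rightarrow> 'a \<Rightarrow> 'a" (infixl \<open>\<star>\<close> 70) where "mul \<equiv> opr M"

lemma carrier_M: "carrier M = Q \<union> \<Sigma> \<union> {z}"
  by (simp add: automatic_algebra_def)

lemma disjoint: "q \<in> Q \<Longrightarrow> q \<notin> \<Sigma>" "q \<in> Q \<Longrightarrow> q \<noteq> z" "q \<in> \<Sigma> \<Longrightarrow> q \<noteq> z" "z \<notin> Q" "z \<notin> \<Sigma>"
  using automaton by (auto simp: partial_automaton_def)

lemma mul_letter_map:
  assumes "q \<in> Q" "\<sigma> \<in> \<Sigma>" shows "q \<star> \<sigma> = letter_map Q \<delta> \<sigma> q"
proof -
  have "q \<in> dom (\<delta> \<sigma>)" using abelian assms by (auto simp: acts_as_abelian_permutation_group_def)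
  with assms show ?thesis by (auto simp: automatic_algebra_def letter_map_def)
qed

lemma letter_map_Bij: "\<sigma> \<in> \<Sigma> \<Longrightarrow> letter_map Q \<delta> \<sigma> \<in> Bij Q"
  using abelian by (auto simp: acts_as_abelian_permutation_group_def)

lemma mul_Q: "q \<in> Q \<Longrightarrow> \<sigma> \<in> \<Sigma> \<Longrightarrow> q \<star> \<sigma> \<in> Q"
  using mul_letter_map letter_map_Bij[THEN Bij_imp_funcset] by (metis PiE)

lemma mul_z: "\<not> (q \<in> Q \<and> \<sigma> \<in> \<Sigma>) \<Longrightarrow> q \<star> \<sigma> = z"
  by (auto simp: automatic_algebra_def)

lemma mul_Q_iff: "q \<star> \<sigma> \<in> Q \<longleftrightarrow> q \<in> Q \<and> \<sigma> \<in> \<Sigma>"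
  using mul_Q mul_z disjoint by metis

lemma mul_not_letter: "q \<star> \<sigma> \<notin> \<Sigma>"
  using mul_Q mul_z disjoint by metis

abbreviation G :: "('a \<Rightarrow> 'a) monoid" where
  "G \<equiv> (BijGroup Q)\<lparr>carrier := letter_map Q \<delta> ` \<Sigma>\<rparr>"

lemma comm_group_G: "comm_group G"
  using abelian by (auto simp: acts_as_abelian_permutation_group_def)

lemma G_mult:
  assumes "\<sigma> \<in> \<Sigma>" "\<tau> \<in> \<Sigma>" "q \<in> Q"
  shows "(letter_map Q \<delta> \<sigma> \<otimes>\<^bsub>G\<^esub> letter_map Q \<delta> \<tau>) q = q \<star> \<tau> \<star> \<sigma>"
  using assms letter_map_Bij mul_letter_map mul_Q
  by (simp add: BijGroup_def compose_def)

lemma mul_commute: "q \<star> \<sigma> \<star> \<tau> = q \<star> \<tau> \<star> \<sigma>"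
proof (cases "q \<in> Q \<and> \<sigma> \<in> \<Sigma> \<and> \<tau> \<in> \<Sigma>")
  case True
  interpret G: comm_group G by (rule comm_group_G)
  have "letter_map Q \<delta> \<sigma> \<otimes>\<^bsub>G\<^esub> letter_map Q \<delta> \<tau> = letter_map Q \<delta> \<tau> \<otimes>\<^bsub>G\<^esub> letter_map Q \<delta> \<sigma>"
    by (rule G.m_comm) (use True in auto)
  with True show ?thesis using G_mult by metis
next
  case False
  then show ?thesis using mul_z mul_Q_iff by metis
qed

lemma identity_letter: "\<exists>\<epsilon>\<in>\<Sigma>. \<forall>q\<in>Q. q \<star> \<epsilon> = q"
proof -
  interpret G: comm_group G by (rule comm_group_G)
  obtain \<epsilon> where \<epsilon>: "\<epsilon> \<in> \<Sigma>" "letter_map Q \<delta> \<epsilon> = \<one>\<^bsub>G\<^esub>" using G.one_closed by auto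
  then have "\<forall>q\<in>Q. q \<star> \<epsilon> = q" using mul_letter_map by (simp add: BijGroup_def)
  with \<epsilon> show ?thesis by blast
qed

lemma composite_letter:
  assumes "\<sigma> \<in> \<Sigma>" "\<tau> \<in> \<Sigma>" shows "\<exists>\<rho>\<in>\<Sigma>. \<forall>q\<in>Q. q \<star> \<rho> = q \<star> \<sigma> \<star> \<tau>"
proof -
  interpret G: comm_group G by (rule comm_group_G)
  have "letter_map Q \<delta> \<tau> \<otimes>\<^bsub>G\<^esub> letter_map Q \<delta> \<sigma> \<in> carrier G"
    by (rule G.m_closed) (use assms in auto)
  then obtain \<rho> where "\<rho> \<in> \<Sigma>" "letter_map Q \<delta> \<rho> = letter_map Q \<delta> \<tau> \<otimes>\<^bsub>G\<^esub> letter_map Q \<delta> \<sigma>" by auto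
  then show ?thesis using G_mult mul_letter_map assms by metis
qed

lemma act_z: "act M z vs = z"
  by (induction vs) (use mul_z disjoint in auto)

text \<open>A word leads to a state only from a state and only through letters.  This makes the set where a
  homomorphism takes states readable from the factors of an element.\<close>

lemma act_Q_iff: "act M q vs \<in> Q \<longleftrightarrow> q \<in> Q \<and> set vs \<subseteq> \<Sigma>"
  by (induction vs arbitrary: q) (auto simp: mul_Q_iff)

lemma act_mset_eq: "mset vs = mset ws \<Longrightarrow> act M q vs = act M q ws"
  unfolding foldl_conv_fold
  by (rule arg_cong[of _ _ "\<lambda>g. g q"], rule fold_multiset_equiv) (auto simp: mul_commute fun_eq_iff)

lemma power_letter:
  assumes "\<sigma> \<in> \<Sigma>" shows "\<exists>\<rho>\<in>\<Sigma>. \<forall>q\<in>Q. q \<star> \<rho> = act M q (replicate k \<sigma>)"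
proof (induction k)
  case 0 then show ?case using identity_letter by simp
next
  case (Suc k)
  then obtain \<rho> where "\<rho> \<in> \<Sigma>" "\<forall>q\<in>Q. q \<star> \<rho> = act M q (replicate k \<sigma>)" by blast
  then show ?case using composite_letter[OF assms, of \<rho>] assms mul_Q by auto
qed

definition exponent :: "nat \<Rightarrow> bool" where
  "exponent k \<longleftrightarrow> k > 0 \<and> (\<forall>\<sigma>\<in>\<Sigma>. \<forall>q\<in>Q. act M q (replicate k \<sigma>) = q)"

lemma exponent_exists: "\<exists>k. exponent k"
proof -
  interpret G: comm_group G by (rule comm_group_G)
  have pow: "act M q (replicate k \<sigma>) = (letter_map Q \<delta> \<sigma> [^]\<^bsub>G\<^esub> k) q"
    if \<sigma>: "\<sigma> \<in> \<Sigma>" and "q \<in> Q" for k \<sigma> q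
    using that(2)
  proof (induction k arbitrary: q)
    case 0 then show ?case by (simp add: BijGroup_def)
  next
    case (Suc k)
    have in_G: "letter_map Q \<delta> \<sigma> [^]\<^bsub>G\<^esub> k \<in> carrier G"
      by (rule G.nat_pow_closed) (use \<sigma> in auto)
    then obtain \<rho> where \<rho>: "\<rho> \<in> \<Sigma>" "letter_map Q \<delta> \<sigma> [^]\<^bsub>G\<^esub> k = letter_map Q \<delta> \<rho>" by auto
    have "act M q (replicate (Suc k) \<sigma>) = q \<star> \<sigma> \<star> \<rho>"
      using Suc \<rho> mul_letter_map mul_Q \<sigma> by simp
    also have "\<dots> = (letter_map Q \<delta> \<rho> \<otimes>\<^bsub>G\<^esub> letter_map Q \<delta> \<sigma>) q"
      using G_mult \<rho> \<sigma> Suc.prems by simp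
    finally show ?case using \<rho> by simp
  qed
  have "finite (carrier G)" using finite_\<Sigma> by simp
  then have "0 < order G" using G.order_gt_0_iff_finite by blast
  moreover have "act M q (replicate (order G) \<sigma>) = q" if "\<sigma> \<in> \<Sigma>" "q \<in> Q" for \<sigma> q
    using pow[OF that] G.pow_order_eq_1[of "letter_map Q \<delta> \<sigma>"] that by (simp add: BijGroup_def)
  ultimately show ?thesis unfolding exponent_def by blast
qed

text \<open>The exponent of the permutation group, as the least common period of all letters; its minimality
  is what provides a state and a letter on which a given smaller power acts nontrivially.\<close>

definition m :: nat where "m = (LEAST k. exponent k)"

lemma m: "m > 0" "\<sigma> \<in> \<Sigma> \<Longrightarrow> q \<in> Q \<Longrightarrow> act M q (replicate m \<sigma>) = q"
  using LeastI_ex[OF exponent_exists] by (simp_all flip: m_def) (simp_all add: exponent_def)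

lemma m_least:
  assumes "0 < n" "n < m" shows "\<exists>\<sigma>\<in>\<Sigma>. \<exists>q\<in>Q. act M q (replicate n \<sigma>) \<noteq> q"
  using not_less_Least[of n exponent] assms unfolding m_def exponent_def by blast

lemma act_torsion:
  assumes "q \<in> Q" "set vs \<subseteq> \<Sigma>" shows "act M q (concat (replicate m vs)) = q"
  using assms
proof (induction vs arbitrary: q)
  case (Cons v vs)
  have "mset (concat (replicate k (v # vs))) = mset (replicate k v @ concat (replicate k vs))" for k
    by (induction k) auto
  then have "act M q (concat (replicate m (v # vs))) = act M (act M q (replicate m v)) (concat (replicate m vs))"
    using act_mset_eq foldl_append by metis
  with Cons m show ?case by auto
qed (simp add: foldl_conv_fold)

lemma act_not_letter: "vs \<noteq> [] \<Longrightarrow> act M q vs \<notin> \<Sigma>"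
proof (induction vs rule: rev_induct)
  case (snoc v vs) then show ?case using mul_not_letter by simp
qed simp

lemma act_replicate_mod:
  assumes "\<sigma> \<in> \<Sigma>" "q \<in> Q" shows "act M q (replicate (k mod m) \<sigma>) = act M q (replicate k \<sigma>)"
proof -
  have *: "act M q (replicate (j * m) \<sigma>) = q" for j
    by (induction j) (simp_all add: replicate_add m(2)[OF assms])
  have "replicate k \<sigma> = replicate (k div m * m) \<sigma> @ replicate (k mod m) \<sigma>"
    by (simp flip: replicate_add)
  then show ?thesis using * by simp
qed

text \<open>The permutations of the letters form a group, so every power of a letter acts as some letter.
  Since the chosen letter depends only on \<open>\<sigma>\<close> and \<open>k\<close>, homomorphisms built from it agree wherever
  their exponents agree.\<close>

definition letter_power :: "'a \<Rightarrow> nat \<Rightarrow> 'a" where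
  "letter_power \<sigma> k = (SOME \<rho>. \<rho> \<in> \<Sigma> \<and> (\<forall>q\<in>Q. q \<star> \<rho> = act M q (replicate k \<sigma>)))"

lemma letter_power:
  assumes "\<sigma> \<in> \<Sigma>"
  shows "letter_power \<sigma> k \<in> \<Sigma>" "q \<in> Q \<Longrightarrow> q \<star> letter_power \<sigma> k = act M q (replicate k \<sigma>)"
proof -
  have "\<exists>\<rho>. \<rho> \<in> \<Sigma> \<and> (\<forall>q\<in>Q. q \<star> \<rho> = act M q (replicate k \<sigma>))" using power_letter[OF assms] by blast
  from someI_ex[OF this] show "letter_power \<sigma> k \<in> \<Sigma>" "q \<in> Q \<Longrightarrow> q \<star> letter_power \<sigma> k = act M q (replicate k \<sigma>)"
    unfolding letter_power_def by blast+
qed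

text \<open>Equality of the effects at a single state \<open>q\<close> is a congruence on words because words commute.\<close>

lemma act_append_cong:
  assumes "act M q vs = act M q vs'" "act M q ws = act M q ws'"
  shows "act M q (vs @ ws) = act M q (vs' @ ws')"
proof -
  have "act M q (vs @ ws) = act M q (vs' @ ws)" using assms(1) by simp
  also have "\<dots> = act M q (ws @ vs')" by (rule act_mset_eq) simp
  also have "\<dots> = act M q (ws' @ vs')" using assms(2) by simp
  also have "\<dots> = act M q (vs' @ ws')" by (rule act_mset_eq) simp
  finally show ?thesis .
qed

end

section \<open>Algebras with enough homomorphisms\<close>

locale separated_algebra = abelian_automaton Q \<Sigma> z \<delta>
  for Q \<Sigma> :: "'a set" and z and \<delta> +
  fixes A :: "'b binar"
  assumes closed: "a \<in> carrier A \<Longrightarrow> b \<in> carrier A \<Longrightarrow> opr A a b \<in> carrier A"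
    and separated: "a \<in> carrier A \<Longrightarrow> b \<in> carrier A \<Longrightarrow>
      (\<And>x. x \<in> binar_hom A M \<Longrightarrow> x a = x b) \<Longrightarrow> a = b"
begin

abbreviation times (infixl \<open>\<cdot>\<close> 70) where "times \<equiv> opr A"
abbreviation X where "X \<equiv> binar_hom A M"

lemma hom_carrier: "x \<in> X \<Longrightarrow> a \<in> carrier A \<Longrightarrow> x a \<in> carrier M"
  by (auto simp: binar_hom_def)

lemma hom_mul: "x \<in> X \<Longrightarrow> a \<in> carrier A \<Longrightarrow> b \<in> carrier A \<Longrightarrow> x (a \<cdot> b) = x a \<star> x b"
  by (auto simp: binar_hom_def)

lemma homI:
  assumes "\<And>a. a \<in> carrier A \<Longrightarrow> g a \<in> carrier M"
    and "\<And>a b. a \<in> carrier A \<Longrightarrow> b \<in> carrier A \<Longrightarrow> g (a \<cdot> b) = g a \<star> g b"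
  shows "restrict g (carrier A) \<in> X"
  using assms closed by (auto simp: binar_hom_def)

lemma act_closed: "a \<in> carrier A \<Longrightarrow> set vs \<subseteq> carrier A \<Longrightarrow> act A a vs \<in> carrier A"
  by (induction vs arbitrary: a) (auto simp: closed)

lemma hom_act:
  "x \<in> X \<Longrightarrow> a \<in> carrier A \<Longrightarrow> set vs \<subseteq> carrier A \<Longrightarrow> x (act A a vs) = act M (x a) (map x vs)"
  by (induction vs arbitrary: a) (auto simp: closed hom_mul)

lemma hom_act_Q_iff:
  assumes "x \<in> X" "a \<in> carrier A" "set vs \<subseteq> carrier A"
  shows "x (act A a vs) \<in> Q \<longleftrightarrow> x a \<in> Q \<and> (\<forall>c\<in>set vs. x c \<in> \<Sigma>)"
  using hom_act[OF assms] act_Q_iff by (auto simp: image_subset_iff)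

lemma act_perm:
  assumes "a \<in> carrier A" "set vs \<subseteq> carrier A" "mset vs = mset ws"
  shows "act A a vs = act A a ws"
proof (rule separated)
  have ws: "set ws \<subseteq> carrier A" using assms by (metis mset_eq_setD)
  then show "act A a vs \<in> carrier A" "act A a ws \<in> carrier A" using act_closed assms by auto
  show "x (act A a vs) = x (act A a ws)" if "x \<in> X" for x
    using that assms ws by (simp add: hom_act act_mset_eq[of "map x vs" "map x ws"])
qed

text \<open>A letter that occurs in a product can be applied \<open>m\<close> more times without effect: where the product
  takes a state, the letter takes a letter of \<open>\<Sigma>\<close>; elsewhere the product is already 0.\<close>

lemma torsion:
  assumes b: "b \<in> carrier A" and vs: "set vs \<subseteq> carrier A" and c: "c \<in> set vs"
  shows "act A (act A b vs) (replicate m c) = act A b vs"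
proof (rule separated)
  have cA: "set (replicate m c) \<subseteq> carrier A" using vs c by auto
  show a: "act A b vs \<in> carrier A" using act_closed b vs by blast
  show "act A (act A b vs) (replicate m c) \<in> carrier A" by (rule act_closed[OF a cA])
  fix x assume x: "x \<in> X"
  have eq: "x (act A (act A b vs) (replicate m c)) = act M (x (act A b vs)) (replicate m (x c))"
    using hom_act[OF x a cA] by simp
  show "x (act A (act A b vs) (replicate m c)) = x (act A b vs)"
  proof (cases "x (act A b vs) \<in> Q")
    case True
    then have "x c \<in> \<Sigma>" using hom_act_Q_iff[OF x b vs] c by blast
    with True show ?thesis unfolding eq by (simp add: m(2))
  next
    case False
    have "map x vs \<noteq> []" using c by auto
    then have "x (act A b vs) \<notin> \<Sigma>" using act_not_letter unfolding hom_act[OF x b vs] by blast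
    with False have "x (act A b vs) = z" using hom_carrier[OF x a] by (auto simp: carrier_M)
    then show ?thesis unfolding eq by (simp add: act_z)
  qed
qed

definition hom_cut :: "('b \<Rightarrow> 'a) \<Rightarrow> 'b set \<Rightarrow> 'b set \<Rightarrow> 'b \<Rightarrow> 'a" where
  "hom_cut x U C = (\<lambda>a\<in>carrier A. if a \<in> U \<union> C then x a else z)"

text \<open>A homomorphism may be replaced by 0 outside a set \<open>U\<close> of elements sent to states and a set \<open>C\<close> of
  elements sent to letters, provided that \<open>U\<close> respects the products that are sent to states.\<close>

lemma cut_hom:
  assumes x: "x \<in> X" and U: "\<And>b. b \<in> U \<Longrightarrow> x b \<in> Q" and C: "\<And>c. c \<in> C \<Longrightarrow> x c \<in> \<Sigma>"
    and iff: "\<And>b c. b \<in> carrier A \<Longrightarrow> c \<in> carrier A \<Longrightarrow> x b \<in> Q \<Longrightarrow> x c \<in> \<Sigma> \<Longrightarrow>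
                b \<cdot> c \<in> U \<longleftrightarrow> b \<in> U \<and> c \<in> C"
  shows "hom_cut x U C \<in> X"
  unfolding hom_cut_def
proof (rule homI)
  show "(if a \<in> U \<union> C then x a else z) \<in> carrier M" if "a \<in> carrier A" for a
    using hom_carrier[OF x that] by (auto simp: carrier_M)
  fix b c assume bc: "b \<in> carrier A" "c \<in> carrier A"
  have eq: "x (b \<cdot> c) = x b \<star> x c" using hom_mul[OF x bc] .
  have nC: "b \<cdot> c \<notin> C" using C mul_not_letter eq by metis
  show "(if b \<cdot> c \<in> U \<union> C then x (b \<cdot> c) else z)
      = (if b \<in> U \<union> C then x b else z) \<star> (if c \<in> U \<union> C then x c else z)" (is "?l = ?r")
  proof (cases "x b \<in> Q \<and> x c \<in> \<Sigma>")
    case True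
    then have "b \<notin> C" "c \<notin> U" using U C disjoint by blast+
    with True iff[OF bc] nC eq show ?thesis using mul_z disjoint by auto
  next
    case False
    then have "b \<cdot> c \<notin> U" using U mul_Q_iff eq by metis
    moreover have "?r = z" by (rule mul_z) (use False disjoint in auto)
    ultimately show ?thesis using nC by simp
  qed
qed

text \<open>The elements from which \<open>a\<close> is reached by applying a word, and those elements whose application
  to \<open>a\<close> can be undone by a word.  Any homomorphism that sends \<open>a\<close> to a state sends the former to
  states and the latter to letters, and can be cut down to just these elements.\<close>

definition divisors :: "'b \<Rightarrow> 'b set" where
  "divisors a = {b \<in> carrier A. \<exists>ws. set ws \<subseteq> carrier A \<and> act A b ws = a}"

definition units :: "'b \<Rightarrow> 'b set" where
  "units a = {c \<in> carrier A. \<exists>ws. set ws \<subseteq> carrier A \<and> act A (a \<cdot> c) ws = a}"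

lemma divisors_carrier: "b \<in> divisors a \<Longrightarrow> b \<in> carrier A" and units_carrier: "c \<in> units a \<Longrightarrow> c \<in> carrier A"
  by (auto simp: divisors_def units_def)

lemma divisors_refl: "a \<in> carrier A \<Longrightarrow> a \<in> divisors a"
  by (auto simp: divisors_def intro!: exI[of _ "[]"])

lemma unitsI:
  assumes "b \<in> carrier A" "set ws \<subseteq> carrier A" "c \<in> set ws"
  shows "c \<in> units (act A b ws)"
proof -
  have "act A (act A b ws \<cdot> c) (replicate (m - 1) c) = act A (act A b ws) (replicate m c)"
    using m(1) by (cases m) auto
  with torsion[OF assms] assms show ?thesis
    unfolding units_def by (intro CollectI conjI exI[of _ "replicate (m - 1) c"]) auto
qed

lemma divisors_mul_iff:
  assumes b: "b \<in> carrier A" and c: "c \<in> carrier A" shows "b \<cdot> c \<in> divisors a \<longleftrightarrow> b \<in> divisors a \<and> c \<in> units a"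
proof
  assume "b \<cdot> c \<in> divisors a"
  then obtain ws where ws: "set ws \<subseteq> carrier A" "act A (b \<cdot> c) ws = a" by (auto simp: divisors_def)
  then have a: "act A b (c # ws) = a" by simp
  have "b \<in> divisors a" unfolding divisors_def using a ws b c by (intro CollectI conjI exI[of _ "c # ws"]) auto
  moreover have "c \<in> units a" using unitsI[of b "c # ws" c] a b c ws by auto
  ultimately show "b \<in> divisors a \<and> c \<in> units a" ..
next
  assume "b \<in> divisors a \<and> c \<in> units a"
  then obtain ws vs where ws: "set ws \<subseteq> carrier A" "act A b ws = a"
    and vs: "set vs \<subseteq> carrier A" "act A (a \<cdot> c) vs = a" by (auto simp: divisors_def units_def)
  have "act A (b \<cdot> c) (ws @ vs) = act A b ((c # ws) @ vs)" by simp
  also have "\<dots> = act A b (ws @ c # vs)" by (rule act_perm) (use b c ws vs in auto)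
  also have "\<dots> = a" using ws vs by simp
  finally show "b \<cdot> c \<in> divisors a"
    unfolding divisors_def using ws vs closed[OF b c] by (intro CollectI conjI exI[of _ "ws @ vs"]) auto
qed

lemma divisors_Q: "x \<in> X \<Longrightarrow> x a \<in> Q \<Longrightarrow> b \<in> divisors a \<Longrightarrow> x b \<in> Q"
  using hom_act_Q_iff by (auto simp: divisors_def)

lemma units_letter:
  assumes "x \<in> X" "a \<in> carrier A" "x a \<in> Q" "c \<in> units a" shows "x c \<in> \<Sigma>"
proof -
  obtain ws where "c \<in> carrier A" "set ws \<subseteq> carrier A" "act A a (c # ws) = a"
    using assms by (auto simp: units_def)
  then show ?thesis using hom_act_Q_iff[OF assms(1,2), of "c # ws"] assms(3) by auto
qed

lemma cut_divisors_hom: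
  assumes "x \<in> X" "a \<in> carrier A" "x a \<in> Q" shows "hom_cut x (divisors a) (units a) \<in> X"
  using assms by (intro cut_hom) (auto simp: divisors_Q units_letter divisors_mul_iff)

lemma cut_divisors_Q_iff:
  assumes "x \<in> X" "a \<in> carrier A" "x a \<in> Q" "b \<in> carrier A"
  shows "hom_cut x (divisors a) (units a) b \<in> Q \<longleftrightarrow> b \<in> divisors a"
  using assms divisors_Q[OF assms(1,3), of b] units_letter[OF assms(1-3), of b] disjoint
  by (auto simp: hom_cut_def)

lemma act_units_divisors:
  assumes "a \<in> carrier A" "b \<in> divisors a" "set vs \<subseteq> units a" shows "act A b vs \<in> divisors a"
  using assms(2,3)
proof (induction vs arbitrary: b)
  case (Cons v vs)
  then have "b \<cdot> v \<in> divisors a" using divisors_mul_iff divisors_carrier units_carrier by auto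
  with Cons show ?case by simp
qed simp

text \<open>If \<open>a\<close> is \<open>b\<close> followed by a word \<open>w\<close>, then \<open>a\<close> followed by the \<open>(m - 1)\<close>-th power of \<open>w\<close> has the
  same value as \<open>b\<close> wherever \<open>a\<close> takes a state.\<close>

lemma divisors_word:
  assumes a: "a \<in> carrier A" and b: "b \<in> divisors a"
  shows "\<exists>vs. set vs \<subseteq> units a \<and> (\<forall>x\<in>X. x a \<in> Q \<longrightarrow> x b = x (act A a vs))"
proof -
  obtain ws where ws: "set ws \<subseteq> carrier A" "act A b ws = a" and bA: "b \<in> carrier A"
    using b by (auto simp: divisors_def)
  define vs where "vs = concat (replicate (m - 1) ws)"
  have vs_ws: "set vs \<subseteq> set ws" by (auto simp: vs_def)
  have "set ws \<subseteq> units a" using unitsI[OF bA ws(1)] ws(2) by auto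
  moreover have "x b = x (act A a vs)" if x: "x \<in> X" "x a \<in> Q" for x
  proof -
    have "x b \<in> Q" using divisors_Q x b by blast
    moreover have *: "set (map x ws) \<subseteq> \<Sigma>" using hom_act_Q_iff[OF x(1) bA ws(1)] x(2) ws(2) by auto
    ultimately have "x b = act M (x b) (concat (replicate m (map x ws)))" using act_torsion by simp
    also have "concat (replicate m (map x ws)) = map x ws @ map x vs"
      unfolding vs_def using m(1) by (cases m) (auto simp: map_concat)
    also have "act M (x b) \<dots> = act M (x a) (map x vs)"
      using hom_act[OF x(1) bA ws(1)] ws(2) by simp
    also have "\<dots> = x (act A a vs)" using hom_act[OF x(1) a, of vs] vs_ws ws by auto
    finally show ?thesis .
  qed
  ultimately show ?thesis using vs_ws by blast
qed

end

section \<open>Letter-valued maps are evaluations at irreducible elements\<close>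

locale local_evaluation = separated_algebra Q \<Sigma> z \<delta> A
  for Q \<Sigma> :: "'a set" and z and \<delta> and A :: "'b binar" +
  fixes f :: "('b \<Rightarrow> 'a) \<Rightarrow> 'a" and F :: "'b set"
  assumes finite_F: "finite F" and F_carrier: "F \<subseteq> carrier A"
    and support: "x \<in> binar_hom A M \<Longrightarrow>
      y \<in> binar_hom A M \<Longrightarrow> (\<And>u. u \<in> F \<Longrightarrow> x u = y u) \<Longrightarrow> f x = f y"
    and local: "finite Y \<Longrightarrow> Y \<subseteq> binar_hom A M \<Longrightarrow>
      \<exists>a\<in>carrier A. \<forall>x\<in>Y. f x = x a"
begin

definition irreducibles :: "'b set" where
  "irreducibles = {a \<in> carrier A. \<forall>b\<in>carrier A. \<forall>c\<in>carrier A. a \<noteq> b \<cdot> c}"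

definition some_letter :: 'a where "some_letter = (SOME \<epsilon>. \<epsilon> \<in> \<Sigma>)"

definition chi :: "'b set \<Rightarrow> 'b \<Rightarrow> 'a" where
  "chi T = (\<lambda>a\<in>carrier A. if a \<in> T then some_letter else z)"

lemma some_letter: "some_letter \<in> \<Sigma>"
  unfolding some_letter_def using identity_letter some_in_eq[of \<Sigma>] by blast

text \<open>All products of letters and 0 are 0, so the values on elements that are not products are
  unconstrained.\<close>

lemma chi_hom:
  assumes "T \<subseteq> irreducibles" shows "chi T \<in> X"
  unfolding chi_def
proof (rule homI)
  show "(if a \<in> T then some_letter else z) \<in> carrier M" for a
    using some_letter by (auto simp: carrier_M)
  fix b c assume "b \<in> carrier A" "c \<in> carrier A"
  then have "b \<cdot> c \<notin> T" using assms by (auto simp: irreducibles_def)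
  moreover have "(if b \<in> T then some_letter else z) \<star> (if c \<in> T then some_letter else z) = z"
    by (rule mul_z) (use some_letter disjoint in auto)
  ultimately show "(if b \<cdot> c \<in> T then some_letter else z)
     = (if b \<in> T then some_letter else z) \<star> (if c \<in> T then some_letter else z)" by simp
qed

lemma chi_z_iff: "b \<in> carrier A \<Longrightarrow> chi T b = z \<longleftrightarrow> b \<notin> T"
  using some_letter disjoint by (auto simp: chi_def)

text \<open>The sets of irreducible elements at whose indicators \<open>f\<close> is nonzero form an ultrafilter; it
  contains the finite set of irreducible members of \<open>F\<close>, so it is principal.  Once \<open>f\<close> is nonzero at the indicator
  of \<open>a\<close>, every local evaluation that includes this indicator is at \<open>a\<close>.\<close>

lemma evaluation_at_irreducible:
  assumes "f (chi irreducibles) \<noteq> z"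
  shows "\<exists>a\<in>carrier A. \<forall>x\<in>X. f x = x a"
proof -
  let ?T = "irreducibles \<inter> F"
  have f_T: "f (chi irreducibles) = f (chi ?T)"
    by (intro support chi_hom) (use F_carrier in \<open>auto simp: chi_def\<close>)
  have fin: "finite ?T" using finite_F by blast
  have sub: "insert (chi ?T) ((\<lambda>a. chi {a}) ` ?T) \<subseteq> X" using chi_hom by auto
  from local[OF _ sub] fin obtain a where a: "a \<in> carrier A"
    "f (chi ?T) = chi ?T a" "\<And>b. b \<in> ?T \<Longrightarrow> f (chi {b}) = chi {b} a" by auto
  then have aT: "a \<in> ?T" using assms f_T chi_z_iff by metis
  then have fa: "f (chi {a}) \<noteq> z" using a chi_z_iff[OF a(1), of "{a}"] by simp
  have chi_a: "chi {a} \<in> X" using aT chi_hom by auto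
  have "f x = x a" if x: "x \<in> X" for x
  proof -
    obtain b where b: "b \<in> carrier A" "f x = x b" "f (chi {a}) = chi {a} b"
      using local[of "{x, chi {a}}"] x chi_a by auto
    then have "b = a" using fa chi_z_iff[OF b(1), of "{a}"] by auto
    with b show ?thesis by simp
  qed
  with a show ?thesis by blast
qed

lemma local_product:
  assumes "f (chi irreducibles) = z" "finite Y" "Y \<subseteq> X"
  shows "\<exists>b\<in>carrier A. \<exists>c\<in>carrier A. \<forall>x\<in>Y. f x = x (b \<cdot> c)"
proof -
  obtain a where a: "a \<in> carrier A" "f (chi irreducibles) = chi irreducibles a" "\<forall>x\<in>Y. f x = x a"
    using local[of "insert (chi irreducibles) Y"] chi_hom assms by auto
  then have "a \<notin> irreducibles" using assms chi_z_iff by metis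
  with a show ?thesis by (auto simp: irreducibles_def)
qed

lemma f_not_Q:
  assumes "f (chi irreducibles) = z" "x \<in> X" "f x \<notin> Q" shows "f x = z"
proof -
  obtain b c where "b \<in> carrier A" "c \<in> carrier A" "f x = x (b \<cdot> c)"
    using local_product[of "{x}"] assms by auto
  with assms show ?thesis using hom_mul mul_Q_iff mul_z by metis
qed

text \<open>The element \<open>a \<cdot> (a \<cdot> a)\<close> is the zero of \<open>A\<close>, as a product never takes a letter as its value.\<close>

lemma evaluation_at_zero:
  assumes "f (chi irreducibles) = z" "\<And>x. x \<in> X \<Longrightarrow> f x \<notin> Q"
  shows "\<exists>a\<in>carrier A. \<forall>x\<in>X. f x = x a"
proof -
  obtain a where a: "a \<in> carrier A" using local[of "{}"] by auto
  then have aa: "a \<cdot> a \<in> carrier A" using closed by blast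
  have "f x = x (a \<cdot> (a \<cdot> a))" if "x \<in> X" for x
  proof -
    have "x (a \<cdot> a) \<notin> \<Sigma>" using hom_mul[OF that a a] mul_not_letter by simp
    then have "x (a \<cdot> (a \<cdot> a)) = z" using hom_mul[OF that a aa] mul_z by simp
    with f_not_Q[OF assms(1) that assms(2)[OF that]] show ?thesis by simp
  qed
  then show ?thesis using closed[OF a aa] by blast
qed

end

section \<open>The support of a state-valued map is principal\<close>

lemma mset_subset_concat_map: "v \<in> set vs \<Longrightarrow> mset (g v) \<subseteq># mset (concat (map g vs))"
  by (induction vs) (auto intro: subset_mset.order_trans mset_subset_eq_add_right)

locale state_valued = local_evaluation Q \<Sigma> z \<delta> A f F
  for Q \<Sigma> :: "'a set" and z and \<delta> and A :: "'b binar" and f F +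
  assumes chi_z: "f (chi irreducibles) = z"
    and nonzero: "\<exists>x\<in>binar_hom A M. f x \<in> Q"
begin

definition V where "V = {x \<in> X. f x \<in> Q}"

text \<open>The homomorphism \<open>com Z\<close> is \<open>x0\<close> cut down to where all members of \<open>Z\<close> are of the same kind, state
  or letter.  For finite \<open>Z \<subseteq> V\<close> a local evaluation shows \<open>com Z \<in> V\<close>, and on the finite set \<open>F\<close> the
  intersection over all of \<open>V\<close> is already reached by a finite \<open>Z\<close>.\<close>

lemma minimal_hom:
  "\<exists>w\<in>V. \<forall>y\<in>V. \<forall>b\<in>carrier A. (w b \<in> Q \<longrightarrow> y b \<in> Q) \<and> (w b \<in> \<Sigma> \<longrightarrow> y b \<in> \<Sigma>)"
proof -
  obtain x0 where x0: "x0 \<in> V" using nonzero by (auto simp: V_def)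
  define com where "com Z = hom_cut x0 {b \<in> carrier A. \<forall>x\<in>Z. x b \<in> Q} {c \<in> carrier A. \<forall>x\<in>Z. x c \<in> \<Sigma>}" for Z
  have com: "com Z \<in> X" if Z: "x0 \<in> Z" "Z \<subseteq> V" for Z
    unfolding com_def
  proof (rule cut_hom)
    fix b c assume bc: "b \<in> carrier A" "c \<in> carrier A"
    have "x (b \<cdot> c) \<in> Q \<longleftrightarrow> x b \<in> Q \<and> x c \<in> \<Sigma>" if "x \<in> Z" for x
    proof -
      have "x \<in> X" using that Z by (auto simp: V_def)
      then show ?thesis using hom_mul[of x b c] bc mul_Q_iff by simp
    qed
    then show "b \<cdot> c \<in> {b \<in> carrier A. \<forall>x\<in>Z. x b \<in> Q} \<longleftrightarrow>
        b \<in> {b \<in> carrier A. \<forall>x\<in>Z. x b \<in> Q} \<and> c \<in> {c \<in> carrier A. \<forall>x\<in>Z. x c \<in> \<Sigma>}"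
      using closed[OF bc] bc by auto
  qed (use Z x0 in \<open>auto simp: V_def\<close>)
  have "\<exists>x\<in>V. x u \<in> Q \<longrightarrow> (\<forall>y\<in>V. y u \<in> Q)" for u using x0 by blast
  then obtain g where g: "\<And>u. g u \<in> V" "\<And>u. g u u \<in> Q \<Longrightarrow> (\<forall>y\<in>V. y u \<in> Q)" by metis
  have "\<exists>x\<in>V. x u \<in> \<Sigma> \<longrightarrow> (\<forall>y\<in>V. y u \<in> \<Sigma>)" for u using x0 by blast
  then obtain h where h: "\<And>u. h u \<in> V" "\<And>u. h u u \<in> \<Sigma> \<Longrightarrow> (\<forall>y\<in>V. y u \<in> \<Sigma>)" by metis
  define Z where "Z = insert x0 (g ` F \<union> h ` F)"
  have Z: "x0 \<in> Z" "Z \<subseteq> V" "finite Z" using x0 g(1) h(1) finite_F by (auto simp: Z_def)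
  have agree: "com V u = com Z u" if u: "u \<in> F" for u
  proof -
    have "(\<forall>x\<in>Z. x u \<in> Q) \<longleftrightarrow> (\<forall>x\<in>V. x u \<in> Q)" using g(2)[of u] Z u by (auto simp: Z_def)
    moreover have "(\<forall>x\<in>Z. x u \<in> \<Sigma>) \<longleftrightarrow> (\<forall>x\<in>V. x u \<in> \<Sigma>)" using h(2)[of u] Z u by (auto simp: Z_def)
    ultimately show ?thesis by (simp add: com_def hom_cut_def)
  qed
  have f_eq: "f (com V) = f (com Z)"
    by (rule support[OF com[OF x0 order_refl] com[OF Z(1,2)] agree])
  have "insert (com Z) Z \<subseteq> X" using com[OF Z(1,2)] Z(2) by (auto simp: V_def)
  then obtain b where b: "b \<in> carrier A" "\<forall>x\<in>insert (com Z) Z. f x = x b"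
    using local[of "insert (com Z) Z"] Z(3) by blast
  have "x b \<in> Q" if "x \<in> Z" for x
  proof -
    have "f x \<in> Q" using that Z(2) by (auto simp: V_def)
    with b that show ?thesis by simp
  qed
  then have "com Z b \<in> Q" using b(1) Z(1) by (auto simp: com_def hom_cut_def)
  then have "f (com V) \<in> Q" using f_eq b by simp
  then have "com V \<in> V" using com[OF x0] by (simp add: V_def)
  moreover have "y b \<in> Q" if "y \<in> V" "b \<in> carrier A" "com V b \<in> Q" for y b
  proof (cases "\<forall>x\<in>V. x b \<in> \<Sigma>")
    case True
    then have "com V b \<in> \<Sigma>" using that x0 by (auto simp: com_def hom_cut_def)
    with that disjoint show ?thesis by blast
  next
    case False
    with that show ?thesis using disjoint by (auto simp: com_def hom_cut_def split: if_splits)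
  qed
  moreover have "y b \<in> \<Sigma>" if "y \<in> V" "b \<in> carrier A" "com V b \<in> \<Sigma>" for y b
  proof (cases "\<forall>x\<in>V. x b \<in> Q")
    case True
    then have "com V b \<in> Q" using that x0 by (auto simp: com_def hom_cut_def)
    with that disjoint show ?thesis by blast
  next
    case False
    with that show ?thesis using disjoint by (auto simp: com_def hom_cut_def split: if_splits)
  qed
  ultimately show ?thesis by blast
qed

text \<open>Let \<open>w\<close> be the homomorphism of least support, sending \<open>U\<close> to states and \<open>C\<close> to letters.  Call two
  elements of \<open>U\<close> connected if words in \<open>C\<close> lead from both to a common element.  Cutting \<open>w\<close> down
  to unions of components and using minimality twice shows first that every component meets \<open>F\<close>, so
  that there are finitely many of them, and then that there is only one.  As \<open>F\<close> is
  finite, a sufficiently long product \<open>a\<close> in this component has all of \<open>F \<inter> U\<close> as divisors and all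
  of \<open>F \<inter> C\<close> as units.  Cutting \<open>w\<close> down to the divisors and units of \<open>a\<close> does not change it
  on \<open>F\<close>, so minimality identifies its support.\<close>

lemma principal_support:
  "\<exists>a\<in>carrier A. (\<exists>b\<in>carrier A. \<exists>vs. vs \<noteq> [] \<and> set vs \<subseteq> carrier A \<and> a = act A b vs) \<and>
     (\<forall>x\<in>X. f x \<in> Q \<longleftrightarrow> x a \<in> Q)"
proof -
  obtain w where wV: "w \<in> V"
    and minQ: "\<And>y b. y \<in> V \<Longrightarrow> b \<in> carrier A \<Longrightarrow> w b \<in> Q \<Longrightarrow> y b \<in> Q"
    and min\<Sigma>: "\<And>y b. y \<in> V \<Longrightarrow> b \<in> carrier A \<Longrightarrow> w b \<in> \<Sigma> \<Longrightarrow> y b \<in> \<Sigma>"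
    using minimal_hom by blast
  have w: "w \<in> X" "f w \<in> Q" using wV by (auto simp: V_def)
  define U where "U = {b \<in> carrier A. w b \<in> Q}"
  define C where "C = {c \<in> carrier A. w c \<in> \<Sigma>}"
  have CA: "set vs \<subseteq> carrier A" if "set vs \<subseteq> C" for vs using that by (auto simp: C_def)
  have act_U: "act A b vs \<in> U \<longleftrightarrow> b \<in> U" if "b \<in> carrier A" "set vs \<subseteq> C" for b vs
    using hom_act_Q_iff[OF w(1) that(1) CA[OF that(2)]] that act_closed[OF that(1) CA[OF that(2)]]
    by (auto simp: U_def C_def)
  define comp where "comp u = {b \<in> U. \<exists>ws vs. set ws \<subseteq> C \<and> set vs \<subseteq> C \<and> act A b ws = act A u vs}" for u
  have comp_refl: "u \<in> comp u" if "u \<in> U" for u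
    using that unfolding comp_def by (auto intro!: exI[of _ "[]"])
  have comp_mul: "b \<cdot> c \<in> comp u \<longleftrightarrow> b \<in> comp u"
    if b: "b \<in> carrier A" "w b \<in> Q" and c: "c \<in> carrier A" "w c \<in> \<Sigma>" and u: "u \<in> U" for b c u
  proof
    assume "b \<cdot> c \<in> comp u"
    then obtain ws vs where "set ws \<subseteq> C" "set vs \<subseteq> C" "act A (b \<cdot> c) ws = act A u vs"
      unfolding comp_def by blast
    then have "set (c # ws) \<subseteq> C" "set vs \<subseteq> C" "act A b (c # ws) = act A u vs"
      using c by (auto simp: C_def)
    with b show "b \<in> comp u" unfolding comp_def U_def by blast
  next
    assume "b \<in> comp u"
    then obtain ws vs where *: "set ws \<subseteq> C" "set vs \<subseteq> C" "act A b ws = act A u vs"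
      unfolding comp_def by blast
    have c': "set [c] \<subseteq> C" using c by (simp add: C_def)
    have "act A (b \<cdot> c) ws = act A b (c # ws)" by simp
    also have "\<dots> = act A b (ws @ [c])" by (rule act_perm) (use b c CA[OF *(1)] in auto)
    also have "\<dots> = act A u (vs @ [c])" using * by simp
    finally have "act A (b \<cdot> c) ws = act A u (vs @ [c])" .
    moreover have "set (vs @ [c]) \<subseteq> C" using c' * by auto
    moreover have "b \<cdot> c \<in> U" using act_U[OF b(1) c'] b by (simp add: U_def)
    ultimately show "b \<cdot> c \<in> comp u" using *(1) unfolding comp_def by blast
  qed
  have cut_comp: "hom_cut w (\<Union>(comp ` S)) C \<in> X" if "S \<subseteq> U" for S
  proof (rule cut_hom[OF w(1)])
    show "w b \<in> Q" if "b \<in> \<Union>(comp ` S)" for b using that by (auto simp: comp_def U_def)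
    show "w c \<in> \<Sigma>" if "c \<in> C" for c using that by (simp add: C_def)
    fix b c assume bc: "b \<in> carrier A" "c \<in> carrier A" "w b \<in> Q" "w c \<in> \<Sigma>"
    then have "c \<in> C" by (simp add: C_def)
    with comp_mul[OF bc(1,3,2,4)] that
    show "b \<cdot> c \<in> \<Union>(comp ` S) \<longleftrightarrow> b \<in> \<Union>(comp ` S) \<and> c \<in> C" by blast
  qed
  \<comment> \<open>Dropping the components that miss \<open>F\<close> does not change \<open>w\<close> on \<open>F\<close>.\<close>
  have U_F: "U \<subseteq> \<Union>(comp ` (F \<inter> U))"
  proof -
    let ?y = "hom_cut w (\<Union>(comp ` (F \<inter> U))) C"
    have y: "?y \<in> X" by (rule cut_comp) auto
    have "f ?y = f w"
    proof (rule support[OF y w(1)])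
      fix u assume u: "u \<in> F"
      then have uA: "u \<in> carrier A" using F_carrier by blast
      show "?y u = w u"
      proof (cases "w u = z")
        case False
        then have "u \<in> U \<or> u \<in> C"
          using hom_carrier[OF w(1) uA] uA by (auto simp: carrier_M U_def C_def)
        with u uA comp_refl show ?thesis by (auto simp: hom_cut_def)
      qed (simp add: hom_cut_def uA)
    qed
    then have "?y \<in> V" using y w by (simp add: V_def)
    then have "?y b \<in> Q" if "b \<in> U" for b using minQ that by (auto simp: U_def)
    then show ?thesis using disjoint by (fastforce simp: hom_cut_def U_def C_def split: if_splits)
  qed
  \<comment> \<open>A common local evaluation at \<open>w\<close> and at its finitely many components picks one component.
    It is at a product \<open>c \<cdot> d\<close>, which also yields a letter \<open>d\<close> in \<open>C\<close>, so that the word below is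
    nonempty.\<close>
  let ?Y = "insert w ((\<lambda>u. hom_cut w (\<Union>(comp ` {u})) C) ` (F \<inter> U))"
  have "hom_cut w (\<Union>(comp ` {u})) C \<in> X" if "u \<in> U" for u by (rule cut_comp) (use that in simp)
  then have "finite ?Y" "?Y \<subseteq> X" using finite_F w by auto
  from local_product[OF chi_z this] obtain c d where cd: "c \<in> carrier A" "d \<in> carrier A"
    "\<forall>x\<in>?Y. f x = x (c \<cdot> d)" by blast
  then have wcd: "w (c \<cdot> d) \<in> Q" using w by simp
  then have "w d \<in> \<Sigma>" using hom_mul[OF w(1) cd(1,2)] mul_Q_iff by simp
  then have d: "d \<in> C" using cd by (simp add: C_def)
  have "c \<cdot> d \<in> U" using wcd closed cd by (simp add: U_def)
  then obtain u where u: "u \<in> F" "u \<in> U" "c \<cdot> d \<in> comp u" using U_F by blast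
  let ?wu = "hom_cut w (\<Union>(comp ` {u})) C"
  have "f ?wu = ?wu (c \<cdot> d)" using cd(3) u by blast
  also have "\<dots> = w (c \<cdot> d)" using u closed cd by (simp add: hom_cut_def)
  finally have "?wu \<in> V" using wcd cut_comp[of "{u}"] u by (simp add: V_def)
  then have "?wu b \<in> Q" if "b \<in> U" for b using minQ that by (auto simp: U_def)
  then have U_u: "U \<subseteq> comp u" using disjoint by (fastforce simp: hom_cut_def U_def C_def split: if_splits)
  have uA: "u \<in> carrier A" using u by (simp add: U_def)
  have "\<forall>v\<in>U. \<exists>p. set (fst p) \<subseteq> C \<and> set (snd p) \<subseteq> C \<and> act A v (fst p) = act A u (snd p)"
    using U_u unfolding comp_def by auto
  from bchoice[OF this] obtain p where p: "\<forall>v\<in>U. set (fst (p v)) \<subseteq> C \<and> set (snd (p v)) \<subseteq> C \<and>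
      act A v (fst (p v)) = act A u (snd (p v))" ..
  define ws where "ws v = fst (p v)" for v
  define vs where "vs v = snd (p v)" for v
  have wv: "set (ws v) \<subseteq> C" "set (vs v) \<subseteq> C" "act A v (ws v) = act A u (vs v)" if "v \<in> U" for v
    using p that by (simp_all add: ws_def vs_def)
  obtain Fs where Fs: "set Fs = F \<inter> U" using finite_list[of "F \<inter> U"] finite_F by auto
  obtain Ls where Ls: "set Ls = F \<inter> C" using finite_list[of "F \<inter> C"] finite_F by auto
  define big where "big = d # Ls @ concat (map vs Fs)"
  have bigC: "set big \<subseteq> C" using d Ls Fs wv(2) by (auto simp: big_def)
  then have bigA: "set big \<subseteq> carrier A" by (rule CA)
  define a where "a = act A u big"
  have aA: "a \<in> carrier A" unfolding a_def by (rule act_closed[OF uA bigA])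
  have wa: "w a \<in> Q" using act_U[OF uA bigC] u by (simp add: a_def U_def)
  have F_up: "v \<in> divisors a" if v: "v \<in> F" "v \<in> U" for v
  proof -
    have "mset (vs v) \<subseteq># mset (concat (map vs Fs))" by (rule mset_subset_concat_map) (use v Fs in auto)
    also have "\<dots> \<subseteq># mset big" by (simp add: big_def)
    finally obtain R where R: "mset big = mset (vs v) + R" by (auto simp: subset_mset.le_iff_add)
    obtain rest where rest: "mset rest = R" using ex_mset by blast
    then have "mset big = mset (vs v @ rest)" using R by simp
    moreover from this have restC: "set rest \<subseteq> carrier A" using bigA by (metis mset_eq_setD set_append Un_subset_iff)
    ultimately have "a = act A u (vs v @ rest)" unfolding a_def by (intro act_perm[OF uA bigA])
    also have "\<dots> = act A v (ws v @ rest)" using wv(3)[OF v(2)] by simp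
    finally have "act A v (ws v @ rest) = a" ..
    moreover have "set (ws v @ rest) \<subseteq> carrier A" using CA[OF wv(1)[OF v(2)]] restC by simp
    ultimately show ?thesis using v unfolding divisors_def U_def by blast
  qed
  have F_units: "c \<in> units a" if "c \<in> F" "c \<in> C" for c
    unfolding a_def by (rule unitsI[OF uA bigA]) (use that Ls in \<open>auto simp: big_def\<close>)
  let ?w = "hom_cut w (divisors a) (units a)"
  have w': "?w \<in> X" by (rule cut_divisors_hom[OF w(1) aA wa])
  have "f ?w = f w"
  proof (rule support[OF w' w(1)])
    fix v assume v: "v \<in> F"
    then have vA: "v \<in> carrier A" using F_carrier by blast
    show "?w v = w v"
    proof (cases "w v = z")
      case False
      then have "v \<in> U \<or> v \<in> C"
        using hom_carrier[OF w(1) vA] vA by (auto simp: carrier_M U_def C_def)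
      with v vA F_up F_units show ?thesis by (auto simp: hom_cut_def)
    qed (simp add: hom_cut_def vA)
  qed
  then have f_w': "f ?w \<in> Q" using w by simp
  have "f x \<in> Q \<longleftrightarrow> x a \<in> Q" if x: "x \<in> X" for x
  proof
    assume "f x \<in> Q"
    then show "x a \<in> Q" using minQ[OF _ aA wa] x by (simp add: V_def)
  next
    assume xa: "x a \<in> Q"
    obtain b where b: "b \<in> carrier A" "f ?w = ?w b" "f x = x b" using local[of "{?w, x}"] w' x by auto
    then have "b \<in> divisors a" using f_w' cut_divisors_Q_iff[OF w(1) aA wa] by simp
    then show "f x \<in> Q" using divisors_Q[OF x xa] b by simp
  qed
  moreover have "big \<noteq> []" by (simp add: big_def)
  ultimately show ?thesis using aA bigA uA unfolding a_def by blast
qed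

end

section \<open>The values of a state-valued map\<close>

locale principal = state_valued Q \<Sigma> z \<delta> A f F
  for Q \<Sigma> :: "'a set" and z and \<delta> and A :: "'b binar" and f F +
  fixes a :: 'b
  assumes a: "a \<in> carrier A"
    and a_product: "\<exists>b\<in>carrier A. \<exists>vs. vs \<noteq> [] \<and> set vs \<subseteq> carrier A \<and> a = act A b vs"
    and f_Q_iff: "x \<in> binar_hom A M \<Longrightarrow> f x \<in> Q \<longleftrightarrow> x a \<in> Q"
begin

definition Xa where "Xa = {x \<in> X. x a \<in> Q}"

lemma Xa_X: "x \<in> Xa \<Longrightarrow> x \<in> X" and Xa_Q: "x \<in> Xa \<Longrightarrow> x a \<in> Q"
  by (auto simp: Xa_def)

lemma Xa_nonempty: "Xa \<noteq> {}"
  using nonzero f_Q_iff by (auto simp: Xa_def)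

lemma hom_a_z:
  assumes "x \<in> X" "x \<notin> Xa" shows "x a = z"
proof -
  obtain b vs where "b \<in> carrier A" "vs \<noteq> []" "set vs \<subseteq> carrier A" "a = act A b vs"
    using a_product by blast
  then have "x a \<notin> \<Sigma>" using hom_act[OF assms(1)] act_not_letter[of "map x vs"] by simp
  then show ?thesis using hom_carrier[OF assms(1) a] assms by (auto simp: carrier_M Xa_def)
qed

lemma units_A: "set vs \<subseteq> units a \<Longrightarrow> set vs \<subseteq> carrier A"
  using units_carrier by blast

lemma hom_word: "x \<in> X \<Longrightarrow> set vs \<subseteq> units a \<Longrightarrow> x (act A a vs) = act M (x a) (map x vs)"
  by (rule hom_act[OF _ a units_A])

lemma word_ext:
  assumes "set v \<subseteq> units a" "set v' \<subseteq> units a" "\<And>x. x \<in> Xa \<Longrightarrow> x (act A a v) = x (act A a v')"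
  shows "act A a v = act A a v'"
proof (rule separated)
  show "act A a v \<in> carrier A" "act A a v' \<in> carrier A" using act_closed[OF a] units_A assms by auto
  show "x (act A a v) = x (act A a v')" if "x \<in> X" for x
  proof (cases "x \<in> Xa")
    case False
    then show ?thesis using hom_word[OF that] assms(1,2) hom_a_z[OF that] by (simp add: act_z)
  qed (rule assms(3))
qed

definition word_of :: "'b \<Rightarrow> 'b list" where
  "word_of b = (SOME v. set v \<subseteq> units a \<and> (\<forall>x\<in>Xa. x b = x (act A a v)))"

lemma word_of:
  assumes "b \<in> divisors a"
  shows "set (word_of b) \<subseteq> units a" "x \<in> Xa \<Longrightarrow> x b = x (act A a (word_of b))"
proof -
  have "\<exists>v. set v \<subseteq> units a \<and> (\<forall>x\<in>Xa. x b = x (act A a v))"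
    using divisors_word[OF a assms] by (auto simp: Xa_def)
  from someI_ex[OF this] show "set (word_of b) \<subseteq> units a" "x \<in> Xa \<Longrightarrow> x b = x (act A a (word_of b))"
    unfolding word_of_def by blast+
qed

text \<open>Including a homomorphism that vanishes off the divisors and units of \<open>a\<close> forces the local
  evaluation to take place at a divisor of \<open>a\<close>, hence at a word applied to \<open>a\<close>.\<close>

lemma word_local:
  assumes "finite Y" "Y \<subseteq> Xa"
  shows "\<exists>v. set v \<subseteq> units a \<and> (\<forall>x\<in>Y. f x = x (act A a v))"
proof -
  obtain x1 where x1: "x1 \<in> X" "x1 a \<in> Q" using Xa_nonempty by (auto simp: Xa_def)
  let ?y = "hom_cut x1 (divisors a) (units a)"
  have y: "?y \<in> X" by (rule cut_divisors_hom[OF x1(1) a x1(2)])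
  have "?y a \<in> Q" using cut_divisors_Q_iff[OF x1(1) a x1(2) a] divisors_refl[OF a] by simp
  then have fy: "f ?y \<in> Q" using f_Q_iff[OF y] by simp
  have "insert ?y Y \<subseteq> X" "finite (insert ?y Y)" using y assms Xa_X by auto
  then obtain b where b: "b \<in> carrier A" "\<forall>x\<in>insert ?y Y. f x = x b" using local by blast
  then have "b \<in> divisors a" using fy cut_divisors_Q_iff[OF x1(1) a x1(2) b(1)] by simp
  with b(2) word_of[OF this] assms(2) show ?thesis by (metis insertCI subsetD)
qed

text \<open>A finite set of letters whose values, together with the value at \<open>a\<close>, determine \<open>f\<close>: the units in
  \<open>F\<close>, and the letters of words that express the divisors in \<open>F\<close>.\<close>

definition L where "L = (F \<inter> units a) \<union> (\<Union>b\<in>F \<inter> divisors a. set (word_of b))"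

lemma L: "finite L" "L \<subseteq> units a"
  using finite_F word_of(1) by (auto simp: L_def)

text \<open>Cutting a homomorphism down to the divisors and units of \<open>a\<close> does not affect \<open>f\<close>, and after
  cutting, \<open>x\<close> and \<open>y\<close> agree on all of \<open>F\<close>.\<close>

lemma letters_determine:
  assumes x: "x \<in> Xa" and y: "y \<in> Xa" and eq: "x a = y a" "\<And>c. c \<in> L \<Longrightarrow> x c = y c"
  shows "f x = f y"
proof -
  have f_cut: "f (hom_cut x (divisors a) (units a)) = f x" if x: "x \<in> Xa" for x
  proof -
    let ?c = "hom_cut x (divisors a) (units a)"
    note xX = Xa_X[OF x] and xQ = Xa_Q[OF x]
    have "?c \<in> Xa" using cut_divisors_hom[OF xX a xQ] cut_divisors_Q_iff[OF xX a xQ a] divisors_refl[OF a]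
      by (simp add: Xa_def)
    then obtain v where v: "set v \<subseteq> units a" "\<forall>y\<in>{?c, x}. f y = y (act A a v)"
      using word_local[of "{?c, x}"] x by auto
    have "act A a v \<in> divisors a" by (rule act_units_divisors[OF a divisors_refl[OF a] v(1)])
    with v show ?thesis using divisors_carrier by (simp add: hom_cut_def)
  qed
  have "f (hom_cut x (divisors a) (units a)) = f (hom_cut y (divisors a) (units a))"
  proof (rule support)
    show "hom_cut x (divisors a) (units a) \<in> X" "hom_cut y (divisors a) (units a) \<in> X"
      using cut_divisors_hom a x y by (auto simp: Xa_def)
    fix u assume u: "u \<in> F"
    have "x u = y u" if up: "u \<in> divisors a"
    proof -
      have "set (word_of u) \<subseteq> L" using u up by (auto simp: L_def)
      then have "map x (word_of u) = map y (word_of u)" using eq by auto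
      then show ?thesis using word_of[OF up] x y eq hom_word Xa_X by metis
    qed
    moreover have "x u = y u" if "u \<in> units a" using eq u that by (auto simp: L_def)
    ultimately show "hom_cut x (divisors a) (units a) u = hom_cut y (divisors a) (units a) u" by (auto simp: hom_cut_def)
  qed
  then show ?thesis using f_cut x y by simp
qed

text \<open>A weight function \<open>l\<close> that is well defined modulo \<open>m\<close> on the elements \<open>a \<cdot> v\<close> lets a power of the
  permutation \<open>\<sigma>\<close> act in place of every word.  The resulting map is extended to all divisors of \<open>a\<close>
  through the words that express them.\<close>

lemma character_hom:
  fixes l :: "'b \<Rightarrow> nat"
  assumes \<sigma>: "\<sigma> \<in> \<Sigma>" and q: "q \<in> Q"
    and l: "\<And>v v'. set v \<subseteq> units a \<Longrightarrow> set v' \<subseteq> units a \<Longrightarrow> act A a v = act A a v' \<Longrightarrow>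
             sum_list (map l v) mod m = sum_list (map l v') mod m"
  shows "\<exists>\<psi>\<in>Xa. (\<forall>v. set v \<subseteq> units a \<longrightarrow> \<psi> (act A a v) = act M q (replicate (sum_list (map l v)) \<sigma>)) \<and>
           (\<forall>c\<in>units a. \<psi> c = letter_power \<sigma> (l c mod m))"
proof -
  define g where "g b = (if b \<in> divisors a then act M q (replicate (sum_list (map l (word_of b))) \<sigma>)
      else if b \<in> units a then letter_power \<sigma> (l b mod m) else z)" for b
  have pow_Q: "act M q (replicate k \<sigma>) \<in> Q" for k using act_Q_iff q \<sigma> by (simp add: set_replicate_conv_if)
  have pow_cong: "act M q (replicate j \<sigma>) = act M q (replicate k \<sigma>)" if "j mod m = k mod m" for j k
    using act_replicate_mod[OF \<sigma> q] that by metis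
  obtain x1 where x1: "x1 \<in> Xa" using Xa_nonempty by blast
  have not_both: "b \<notin> units a" if "b \<in> divisors a" for b
    using divisors_Q[OF Xa_X[OF x1] Xa_Q[OF x1] that] units_letter[OF Xa_X[OF x1] a Xa_Q[OF x1]] disjoint by blast
  have g_up: "g b = act M q (replicate (sum_list (map l v)) \<sigma>)"
    if b: "b \<in> divisors a" and v: "set v \<subseteq> units a" "\<And>x. x \<in> Xa \<Longrightarrow> x b = x (act A a v)" for b v
  proof -
    have "act A a (word_of b) = act A a v"
      by (rule word_ext[OF word_of(1)[OF b] v(1)]) (metis v(2) word_of(2)[OF b])
    from pow_cong[OF l[OF word_of(1)[OF b] v(1) this]] b show ?thesis by (simp add: g_def)
  qed
  have g_units: "g c = letter_power \<sigma> (l c mod m)" if "c \<in> units a" for c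
    using that not_both by (auto simp: g_def)
  have gQ: "g b \<in> Q \<longleftrightarrow> b \<in> divisors a" and g\<Sigma>: "g b \<in> \<Sigma> \<longleftrightarrow> b \<in> units a" for b
    using pow_Q letter_power(1)[OF \<sigma>] disjoint not_both unfolding g_def by auto
  let ?\<psi> = "restrict g (carrier A)"
  have "?\<psi> \<in> X"
  proof (rule homI)
    show "g b \<in> carrier M" for b
      using pow_Q letter_power(1)[OF \<sigma>] by (auto simp: g_def carrier_M)
    fix b c assume bc: "b \<in> carrier A" "c \<in> carrier A"
    show "g (b \<cdot> c) = g b \<star> g c"
    proof (cases "b \<in> divisors a \<and> c \<in> units a")
      case True
      then have up: "b \<cdot> c \<in> divisors a" using divisors_mul_iff bc by blast
      have W: "set (word_of b @ [c]) \<subseteq> units a" using word_of(1) True by auto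
      have "x (b \<cdot> c) = x (act A a (word_of b @ [c]))" if x: "x \<in> Xa" for x
      proof -
        have "x (b \<cdot> c) = x (act A a (word_of b)) \<star> x c"
          using hom_mul[OF Xa_X[OF x] bc] word_of(2)[OF _ x] True by simp
        also have "\<dots> = x (act A a (word_of b @ [c]))"
          using hom_word[OF Xa_X[OF x] W] hom_word[OF Xa_X[OF x], of "word_of b"] W by simp
        finally show ?thesis .
      qed
      from g_up[OF up W this]
      have "g (b \<cdot> c) = act M (act M q (replicate (sum_list (map l (word_of b))) \<sigma>)) (replicate (l c) \<sigma>)"
        by (simp add: replicate_add)
      also have "act M q (replicate (sum_list (map l (word_of b))) \<sigma>) = g b" using True by (simp add: g_def)
      also have "act M (g b) (replicate (l c) \<sigma>) = act M (g b) (replicate (l c mod m) \<sigma>)"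
        using act_replicate_mod[OF \<sigma>] gQ True by simp
      also have "\<dots> = g b \<star> g c" using letter_power(2)[OF \<sigma>] gQ True g_units by simp
      finally show ?thesis .
    next
      case False
      have "b \<cdot> c \<notin> units a"
        using units_letter[OF Xa_X[OF x1] a Xa_Q[OF x1]] hom_mul[OF Xa_X[OF x1] bc] mul_not_letter by metis
      moreover have "b \<cdot> c \<notin> divisors a" using False divisors_mul_iff[OF bc] by blast
      ultimately have "g (b \<cdot> c) = z" by (simp add: g_def)
      also have "z = g b \<star> g c" by (rule mul_z[symmetric]) (use False gQ g\<Sigma> in blast)
      finally show ?thesis .
    qed
  qed
  moreover have val: "?\<psi> (act A a v) = act M q (replicate (sum_list (map l v)) \<sigma>)"
    if "set v \<subseteq> units a" for v
    using g_up[OF act_units_divisors[OF a divisors_refl[OF a] that] that] act_closed[OF a units_A[OF that]] by simp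
  moreover have "?\<psi> a \<in> Q" using gQ divisors_refl[OF a] a by simp
  moreover have "?\<psi> c = letter_power \<sigma> (l c mod m)" if "c \<in> units a" for c
    using that g_units units_carrier by simp
  ultimately show ?thesis unfolding Xa_def by (intro bexI[of _ ?\<psi>]) auto
qed

text \<open>Let \<open>h\<close> be a word that the members of \<open>Y\<close> separate from all words over \<open>L\<close>, and let \<open>P\<close> be the
  monoid of those words that \<open>Y\<close> identifies with words over \<open>L\<close>.  A character that is trivial on \<open>P\<close>
  but not at \<open>h\<close> yields a homomorphism \<open>\<psi>\<close> that agrees on \<open>L\<close> with the homomorphism \<open>\<psi>0\<close> of weight 0, so \<open>f\<close> takes
  the same value on both, while evaluation at \<open>h\<close>, or at any word that \<open>Y\<close> identifies with \<open>h\<close>,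
  tells them apart.\<close>

lemma separating_character:
  assumes Y: "Y \<subseteq> Xa" and h: "set h \<subseteq> units a"
    and no: "\<And>k. set k \<subseteq> L \<Longrightarrow> \<exists>x\<in>Y. x (act A a h) \<noteq> x (act A a k)"
  shows "\<exists>\<psi>\<in>Xa. \<exists>\<psi>0\<in>Xa. f \<psi> = f \<psi>0 \<and>
     (\<forall>v. set v \<subseteq> units a \<longrightarrow> (\<forall>x\<in>Y. x (act A a v) = x (act A a h)) \<longrightarrow> \<psi> (act A a v) \<noteq> \<psi>0 (act A a v))"
proof -
  define E where "E v v' \<longleftrightarrow> (\<forall>x\<in>Y. act M (x a) (map x v) = act M (x a) (map x v'))" for v v'
  have E_iff: "E v v' \<longleftrightarrow> (\<forall>x\<in>Y. x (act A a v) = x (act A a v'))"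
    if "set v \<subseteq> units a" "set v' \<subseteq> units a" for v v'
    unfolding E_def using hom_word[OF Xa_X[OF subsetD[OF Y]]] that by simp
  have E_refl: "E v v" and E_sym: "E v v' \<Longrightarrow> E v' v" and E_trans: "E v v' \<Longrightarrow> E v' v'' \<Longrightarrow> E v v''"
    for v v' v'' by (simp_all add: E_def)
  have E_append: "E (v @ w) (v' @ w')" if "E v v'" "E w w'" for v v' w w'
    using that unfolding E_def map_append by (blast intro: act_append_cong)
  have E_perm: "E v w" if "mset v = mset w" for v w
    using that unfolding E_def by (auto intro!: act_mset_eq)
  define rep where "rep k v = concat (replicate k v)" for k and v :: "'b list"
  have rep_sub: "set (rep k v) \<subseteq> set v" for k v by (auto simp: rep_def)
  have mset_rep: "mset (rep k v) = repeat_mset k (mset v)" for k v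
    by (induction k) (simp_all add: rep_def)
  have E_rep: "E (rep m v) []" if "set v \<subseteq> units a" for v
    unfolding E_def
  proof
    fix x assume "x \<in> Y"
    then have x: "x \<in> X" "x a \<in> Q" using Y Xa_def by auto
    then have "set (map x v) \<subseteq> \<Sigma>" using units_letter[OF x(1) a x(2)] that by auto
    with act_torsion[OF x(2)] show "act M (x a) (map x (rep m v)) = act M (x a) (map x [])"
      by (simp add: rep_def map_concat)
  qed
  have m_split: "v @ rep (m - 1) v = rep m v" for v
    using m(1) by (cases m) (simp_all add: rep_def)
  \<comment> \<open>Characters are taken on multisets over the whole type; elements that are not units of \<open>a\<close> are
    ignored.\<close>
  define filt where "filt V = filter_mset (\<lambda>c. c \<in> units a) V" for V
  define P where "P = {V. \<exists>v k. mset v = filt V \<and> set k \<subseteq> L \<and> E v k}"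
  have set_filt: "set v \<subseteq> units a" if "mset v = filt V" for v V
    using that unfolding filt_def by (metis set_mset_mset set_mset_filter mem_Collect_eq subsetI)
  have filt_mset: "filt (mset v) = mset v" if "set v \<subseteq> units a" for v
    using that by (auto simp: filt_def filter_mset_eq_conv)
  have mset_P: "mset v \<in> P \<longleftrightarrow> (\<exists>k. set k \<subseteq> L \<and> E v k)" if v: "set v \<subseteq> units a" for v
  proof
    assume "mset v \<in> P"
    then have "\<exists>v' k. mset v' = mset v \<and> set k \<subseteq> L \<and> E v' k" by (simp add: P_def filt_mset[OF v])
    then obtain v' k where "mset v' = mset v" "set k \<subseteq> L" "E v' k" by (elim exE conjE)
    with E_trans[OF E_perm[of v v']] show "\<exists>k. set k \<subseteq> L \<and> E v k" by auto
  qed (auto simp: P_def filt_mset[OF v])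
  have "\<exists>(l :: 'b \<Rightarrow> nat) n. 0 < n \<and> n < m \<and> (\<forall>V\<in>P. m dvd (\<Sum>c\<in>#V. l c)) \<and>
           (\<Sum>c\<in>#mset h. l c) mod m = n"
  proof (rule exists_character)
    show "{#} \<in> P" unfolding P_def filt_def by (auto intro!: exI[of _ "[]"] E_refl)
    show "mset h \<notin> P" unfolding mset_P[OF h] using no E_iff[OF h] L(2) by blast
    show "0 < m" by (rule m(1))
  next
    fix V W assume "V \<in> P" "W \<in> P"
    then obtain v k w j where *: "mset v = filt V" "set k \<subseteq> L" "E v k" "mset w = filt W" "set j \<subseteq> L" "E w j"
      unfolding P_def by blast
    then have "mset (v @ w) = filt (V + W)" "set (k @ j) \<subseteq> L" "E (v @ w) (k @ j)"
      using E_append by (auto simp: filt_def)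
    then show "V + W \<in> P" unfolding P_def by blast
  next
    fix V W assume "V + W \<in> P" "W \<in> P"
    then obtain u k w j where *: "mset u = filt (V + W)" "set k \<subseteq> L" "E u k" "mset w = filt W" "set j \<subseteq> L" "E w j"
      unfolding P_def by blast
    obtain v where v: "mset v = filt V" using ex_mset by blast
    have "mset u = mset (v @ w)" using * v by (simp add: filt_def)
    then have vw: "E (v @ w) k" using E_perm E_trans *(3) by metis
    have jL: "set j \<subseteq> units a" using * L by blast
    have "E (v @ w @ rep (m - 1) j) (v @ j @ rep (m - 1) j)"
      by (intro E_append E_refl *)
    moreover have "E (v @ j @ rep (m - 1) j) (v @ [])"
      unfolding m_split by (intro E_append E_refl E_rep jL)
    moreover have "E ((v @ w) @ rep (m - 1) j) (k @ rep (m - 1) j)" by (intro E_append E_refl vw)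
    ultimately have "E v (k @ rep (m - 1) j)" using E_trans E_sym by (metis append.assoc append_Nil2)
    moreover have "set (k @ rep (m - 1) j) \<subseteq> L" using * rep_sub by fastforce
    ultimately show "V \<in> P" using v unfolding P_def by blast
  next
    fix V
    obtain v where v: "mset v = filt V" using ex_mset by blast
    have "mset (rep m v) = filt (repeat_mset m V)"
      unfolding mset_rep v filt_def by (rule multiset_eqI) simp
    moreover have "set [] \<subseteq> L" by simp
    ultimately show "repeat_mset m V \<in> P" unfolding P_def using E_rep[OF set_filt[OF v]] by blast
  qed
  then obtain l n where n: "0 < n" "n < m" and lP: "\<And>V. V \<in> P \<Longrightarrow> m dvd (\<Sum>c\<in>#V. l c)"
    and lh: "(\<Sum>c\<in>#mset h. l c) mod m = n" by blast
  define s where "s v = sum_list (map l v)" for v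
  have s_mset: "(\<Sum>c\<in>#mset v. l c) = s v" for v by (simp add: s_def flip: sum_mset_sum_list)
  have s_append: "s (v @ w) = s v + s w" for v w by (simp add: s_def)
  have s_rep: "s (rep k v) = k * s v" for k v by (induction k) (simp_all add: rep_def s_def)
  have s_cong: "s v mod m = s v' mod m" if "set v \<subseteq> units a" "set v' \<subseteq> units a" "E v v'" for v v'
  proof -
    have sub: "set (v @ rep (m - 1) v') \<subseteq> units a" using that rep_sub by fastforce
    have "E (v @ rep (m - 1) v') (v' @ rep (m - 1) v')" by (intro E_append E_refl that)
    then have "E (v @ rep (m - 1) v') []" unfolding m_split using E_rep[OF that(2)] by (rule E_trans)
    then have "mset (v @ rep (m - 1) v') \<in> P" unfolding mset_P[OF sub] by (auto intro!: exI[of _ "[]"])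
    from lP[OF this] have "m dvd s v + (m - 1) * s v'" unfolding s_mset s_append s_rep .
    then have "(s v + (m - 1) * s v' + s v') mod m = s v' mod m" by auto
    moreover have "s v + (m - 1) * s v' + s v' = s v + m * s v'" using m(1) by (cases m) auto
    ultimately show ?thesis by (metis mod_mult_self2)
  qed
  \<comment> \<open>As \<open>n\<close> is smaller than the exponent, some letter has a nontrivial \<open>n\<close>-th power.\<close>
  obtain \<sigma> q where \<sigma>: "\<sigma> \<in> \<Sigma>" and q: "q \<in> Q" and nq: "act M q (replicate n \<sigma>) \<noteq> q"
    using m_least[OF n] by blast
  obtain \<psi> where \<psi>: "\<psi> \<in> Xa" "\<And>v. set v \<subseteq> units a \<Longrightarrow> \<psi> (act A a v) = act M q (replicate (s v) \<sigma>)"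
    "\<And>c. c \<in> units a \<Longrightarrow> \<psi> c = letter_power \<sigma> (l c mod m)"
    using character_hom[OF \<sigma> q, of l] s_cong E_iff unfolding s_def by metis
  obtain \<psi>0 where "\<psi>0 \<in> Xa" "\<And>v. set v \<subseteq> units a \<Longrightarrow> \<psi>0 (act A a v) = act M q (replicate (sum_list (map (\<lambda>_. 0) v)) \<sigma>)"
    "\<And>c. c \<in> units a \<Longrightarrow> \<psi>0 c = letter_power \<sigma> (0 mod m)"
    using character_hom[OF \<sigma> q, of "\<lambda>_. 0"] by auto
  then have \<psi>0: "\<psi>0 \<in> Xa" "\<And>v. set v \<subseteq> units a \<Longrightarrow> \<psi>0 (act A a v) = q"
    "\<And>c. c \<in> units a \<Longrightarrow> \<psi>0 c = letter_power \<sigma> 0"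
    by (simp_all add: sum_list_0)
  have "f \<psi> = f \<psi>0"
  proof (rule letters_determine[OF \<psi>(1) \<psi>0(1)])
    show "\<psi> a = \<psi>0 a" using \<psi>(2)[of "[]"] \<psi>0(2)[of "[]"] by (simp add: s_def)
    fix c assume c: "c \<in> L"
    then have cl: "set [c] \<subseteq> units a" using L by auto
    have "mset [c] \<in> P" unfolding mset_P[OF cl] using c E_refl by (intro exI[of _ "[c]"]) auto
    from lP[OF this] have "l c mod m = 0" by simp
    then show "\<psi> c = \<psi>0 c" using \<psi>(3) \<psi>0(3) cl by simp
  qed
  moreover have "\<psi> (act A a v) \<noteq> \<psi>0 (act A a v)"
    if v: "set v \<subseteq> units a" and vh: "\<forall>x\<in>Y. x (act A a v) = x (act A a h)" for v
  proof -
    have "s v mod m = n" using s_cong[OF v h] E_iff[OF v h] vh lh s_mset by simp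
    then have "act M q (replicate (s v) \<sigma>) = act M q (replicate n \<sigma>)"
      using act_replicate_mod[OF \<sigma> q, of "s v"] by simp
    with nq show ?thesis using \<psi>(2) \<psi>0(2) v by simp
  qed
  ultimately show ?thesis using \<psi>(1) \<psi>0(1) by blast
qed

text \<open>Up to their values under the finite set \<open>Y\<close> there are finitely many words, so finitely many pairs
  of separating characters suffice to exclude every local evaluation at a word not identified with
  a word over \<open>L\<close>.\<close>

lemma finite_word_local:
  assumes Y: "finite Y" "Y \<subseteq> Xa"
  shows "\<exists>k. set k \<subseteq> L \<and> (\<forall>x\<in>Y. f x = x (act A a k))"
proof (rule ccontr)
  assume contra: "\<not> ?thesis"
  define W where "W = {h. set h \<subseteq> units a \<and> (\<forall>k. set k \<subseteq> L \<longrightarrow> (\<exists>x\<in>Y. x (act A a h) \<noteq> x (act A a k)))}"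
  have "\<forall>h\<in>W. \<exists>\<psi> \<psi>0. \<psi> \<in> Xa \<and> \<psi>0 \<in> Xa \<and> f \<psi> = f \<psi>0 \<and>
     (\<forall>v. set v \<subseteq> units a \<longrightarrow> (\<forall>x\<in>Y. x (act A a v) = x (act A a h)) \<longrightarrow> \<psi> (act A a v) \<noteq> \<psi>0 (act A a v))"
    using separating_character[OF Y(2)] unfolding W_def by blast
  then obtain \<psi> \<psi>0 where \<psi>: "\<And>h. h \<in> W \<Longrightarrow> \<psi> h \<in> Xa \<and> \<psi>0 h \<in> Xa \<and> f (\<psi> h) = f (\<psi>0 h) \<and>
     (\<forall>v. set v \<subseteq> units a \<longrightarrow> (\<forall>x\<in>Y. x (act A a v) = x (act A a h)) \<longrightarrow> \<psi> h (act A a v) \<noteq> \<psi>0 h (act A a v))"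
    by metis
  define \<nu> where "\<nu> h = (\<lambda>x\<in>Y. x (act A a h))" for h
  have "\<nu> ` W \<subseteq> Y \<rightarrow>\<^sub>E Q"
  proof
    fix t assume "t \<in> \<nu> ` W"
    then obtain h where h: "t = \<nu> h" "set h \<subseteq> units a" unfolding W_def by blast
    have "x (act A a h) \<in> Q" if "x \<in> Y" for x
    proof -
      have "x \<in> X" "x a \<in> Q" using that Y by (auto simp: Xa_def)
      then show ?thesis using divisors_Q act_units_divisors[OF a divisors_refl[OF a] h(2)] by blast
    qed
    with h show "t \<in> Y \<rightarrow>\<^sub>E Q" by (auto simp: \<nu>_def)
  qed
  then have "finite (\<nu> ` W)" using finite_PiE[OF Y(1) finite_Q] finite_subset by metis
  from finite_subset_image[OF this order_refl] obtain W0 where W0: "W0 \<subseteq> W" "finite W0" "\<nu> ` W = \<nu> ` W0" by blast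
  let ?Y = "Y \<union> \<psi> ` W0 \<union> \<psi>0 ` W0"
  have "finite ?Y" "?Y \<subseteq> Xa" using Y W0 \<psi> by auto
  from word_local[OF this] obtain v where v: "set v \<subseteq> units a" "\<forall>x\<in>?Y. f x = x (act A a v)" by blast
  have "v \<in> W" unfolding W_def
  proof (intro CollectI conjI allI impI v)
    fix k assume "set k \<subseteq> L"
    then obtain x where x: "x \<in> Y" "f x \<noteq> x (act A a k)" using contra by blast
    with v have "x (act A a v) \<noteq> x (act A a k)" by auto
    with x show "\<exists>x\<in>Y. x (act A a v) \<noteq> x (act A a k)" by blast
  qed
  then obtain h where h: "h \<in> W0" "\<nu> v = \<nu> h" using W0 by blast
  have "x (act A a v) = x (act A a h)" if "x \<in> Y" for x
    using fun_cong[OF h(2), of x] that by (simp add: \<nu>_def)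
  then have "\<psi> h (act A a v) \<noteq> \<psi>0 h (act A a v)" "f (\<psi> h) = f (\<psi>0 h)" using \<psi>[of h] h W0 v by auto
  moreover have "f (\<psi> h) = \<psi> h (act A a v)" "f (\<psi>0 h) = \<psi>0 h (act A a v)" using v h by auto
  ultimately show False by simp
qed

text \<open>The homomorphisms with \<open>x a \<in> Q\<close> have finitely many restrictions to \<open>a\<close> and \<open>L\<close>.  Both \<open>f\<close> and the
  evaluation at a word over \<open>L\<close> depend only on that restriction, so agreement on one representative
  of each suffices.\<close>

lemma evaluation_at_word: "\<exists>b\<in>carrier A. \<forall>x\<in>X. f x = x b"
proof -
  define \<rho> where "\<rho> x = (x a, restrict x L)" for x :: "'b \<Rightarrow> 'a"
  have "\<rho> ` Xa \<subseteq> Q \<times> (L \<rightarrow>\<^sub>E \<Sigma>)"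
  proof
    fix t assume "t \<in> \<rho> ` Xa"
    then obtain x where x: "t = \<rho> x" "x \<in> X" "x a \<in> Q" by (auto simp: Xa_def)
    have "x c \<in> \<Sigma>" if "c \<in> L" for c using units_letter[OF x(2) a x(3)] L(2) that by blast
    with x show "t \<in> Q \<times> (L \<rightarrow>\<^sub>E \<Sigma>)" by (auto simp: \<rho>_def)
  qed
  moreover have "finite (Q \<times> (L \<rightarrow>\<^sub>E \<Sigma>))" using finite_Q finite_PiE[OF L(1) finite_\<Sigma>] by blast
  ultimately have "finite (\<rho> ` Xa)" by (rule finite_subset)
  from finite_subset_image[OF this order_refl] obtain Y where Y: "Y \<subseteq> Xa" "finite Y" "\<rho> ` Xa = \<rho> ` Y" by blast
  from finite_word_local[OF Y(2,1)] obtain k where k: "set k \<subseteq> L" "\<forall>x\<in>Y. f x = x (act A a k)" by blast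
  have kl: "set k \<subseteq> units a" using k L by blast
  have "f x = x (act A a k)" if x: "x \<in> X" for x
  proof (cases "x \<in> Xa")
    case True
    then obtain y where y: "y \<in> Y" "\<rho> x = \<rho> y" using Y by blast
    then have yX: "y \<in> Xa" using Y by blast
    have xa: "x a = y a" using y(2) by (simp add: \<rho>_def)
    have xL: "x c = y c" if "c \<in> L" for c
    proof -
      have "restrict x L = restrict y L" using y(2) by (simp add: \<rho>_def)
      then have "restrict x L c = restrict y L c" by (rule fun_cong)
      with that show ?thesis by simp
    qed
    have "f x = f y" by (rule letters_determine[OF True yX xa xL])
    also have "\<dots> = act M (y a) (map y k)" using k y hom_word[OF Xa_X[OF yX] kl] by simp
    also have "map y k = map x k" using xL k by auto
    also have "act M (y a) (map x k) = x (act A a k)" using xa hom_word[OF x kl] by simp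
    finally show ?thesis .
  next
    case False
    then have "f x \<notin> Q" using f_Q_iff x by (simp add: Xa_def)
    then show ?thesis using f_not_Q[OF chi_z x] hom_word[OF x kl] hom_a_z[OF x False] act_z by simp
  qed
  then show ?thesis using act_closed[OF a units_A[OF kl]] by blast
qed

end

section \<open>Locality of continuous maps that preserve the compatible relations\<close>

lemma openin_cylinder:
  assumes "finite F" "F \<subseteq> I" "x \<in> I \<rightarrow>\<^sub>E C"
  shows "openin (product_topology (\<lambda>_. discrete_topology C) I) {y \<in> I \<rightarrow>\<^sub>E C. \<forall>i\<in>F. y i = x i}"
proof -
  let ?S = "\<lambda>i. if i \<in> F then {x i} else C"
  have eq: "{y \<in> I \<rightarrow>\<^sub>E C. \<forall>i\<in>F. y i = x i} = PiE I ?S"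
  proof (rule subset_antisym; rule subsetI)
    fix y assume "y \<in> PiE I ?S"
    then have y: "y \<in> extensional I" "\<And>i. i \<in> I \<Longrightarrow> y i \<in> ?S i" by (simp_all add: PiE_iff)
    have "y i \<in> C" if "i \<in> I" for i using y(2)[OF that] PiE_mem[OF assms(3) that] by (simp split: if_splits)
    moreover have "y i = x i" if "i \<in> F" for i using y(2)[of i] that assms(2) by auto
    ultimately show "y \<in> {y \<in> I \<rightarrow>\<^sub>E C. \<forall>i\<in>F. y i = x i}" using y(1) by (simp add: PiE_iff)
  qed (simp add: PiE_iff)
  have "finite {i \<in> I. ?S i \<noteq> C}" by (rule finite_subset[OF _ assms(1)]) auto
  moreover have "?S i \<subseteq> C" if "i \<in> I" for i using PiE_mem[OF assms(3) that] by simp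
  ultimately show ?thesis unfolding eq by (simp add: openin_PiE_gen)
qed

text \<open>A failure of the homomorphism condition involves three elements only, so the homomorphisms are
  closed in a power of a finite discrete space.\<close>

lemma compactin_binar_hom:
  assumes A: "binar_algebra A" and fin: "finite (carrier M)"
  shows "compactin (product_topology (\<lambda>_. discrete_topology (carrier M)) (carrier A)) (binar_hom A M)"
proof -
  let ?P = "product_topology (\<lambda>_. discrete_topology (carrier M)) (carrier A)"
  have "compact_space ?P" using fin by (simp add: compact_space_product_topology compact_space_discrete_topology)
  moreover have "closedin ?P (binar_hom A M)"
    unfolding closedin_def
  proof
    show "binar_hom A M \<subseteq> topspace ?P" by (auto simp: binar_hom_def)
    show "openin ?P (topspace ?P - binar_hom A M)"
    proof (subst openin_subopen, intro ballI)
      fix x assume "x \<in> topspace ?P - binar_hom A M"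
      then obtain a b where x: "x \<in> carrier A \<rightarrow>\<^sub>E carrier M" and ab: "a \<in> carrier A" "b \<in> carrier A"
        and neq: "x (opr A a b) \<noteq> opr M (x a) (x b)" by (auto simp: binar_hom_def)
      let ?F = "{a, b, opr A a b}"
      have "openin ?P {y \<in> carrier A \<rightarrow>\<^sub>E carrier M. \<forall>i\<in>?F. y i = x i}"
        by (rule openin_cylinder) (use A ab x in \<open>auto simp: binar_algebra_def\<close>)
      moreover have "{y \<in> carrier A \<rightarrow>\<^sub>E carrier M. \<forall>i\<in>?F. y i = x i} \<subseteq> topspace ?P - binar_hom A M"
        using neq ab by (auto simp: binar_hom_def)
      ultimately show "\<exists>T. openin ?P T \<and> x \<in> T \<and> T \<subseteq> topspace ?P - binar_hom A M"
        using x by (intro exI[of _ "{y \<in> carrier A \<rightarrow>\<^sub>E carrier M. \<forall>i\<in>?F. y i = x i}"]) auto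
    qed
  qed
  ultimately show ?thesis by (rule closedin_compact_space)
qed

lemma continuous_finite_support:
  assumes A: "binar_algebra A" and fin: "finite (carrier M)"
    and f: "continuous_map (hom_topology A M) (discrete_topology (carrier M)) f"
  shows "\<exists>F. finite F \<and> F \<subseteq> carrier A \<and>
    (\<forall>x\<in>binar_hom A M. \<forall>y\<in>binar_hom A M. (\<forall>u\<in>F. x u = y u) \<longrightarrow> f x = f y)"
proof -
  let ?X = "binar_hom A M" and ?E = "carrier A \<rightarrow>\<^sub>E carrier M"
  let ?P = "product_topology (\<lambda>_. discrete_topology (carrier M)) (carrier A)"
  have X_E: "?X \<subseteq> ?E" unfolding binar_hom_def by (rule Collect_restrict)
  then have top: "topspace (hom_topology A M) = ?X" by (simp add: hom_topology_def Int_absorb1)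
  have "\<exists>F. finite F \<and> F \<subseteq> carrier A \<and> (\<forall>y\<in>?X. (\<forall>u\<in>F. y u = x u) \<longrightarrow> f y = f x)" if x: "x \<in> ?X" for x
  proof -
    have "f x \<in> carrier M" using f x top by (auto simp: continuous_map_def)
    then have "openin (hom_topology A M) {y \<in> topspace (hom_topology A M). f y \<in> {f x}}"
      by (intro openin_continuous_map_preimage[OF f]) auto
    then obtain U where U: "openin ?P U" "{y \<in> ?X. f y = f x} = U \<inter> ?X"
      unfolding top by (auto simp: hom_topology_def openin_subtopology)
    then have "x \<in> U" using x by blast
    with U(1) obtain V where V: "finite {i \<in> carrier A. V i \<noteq> carrier M}" "x \<in> PiE (carrier A) V"
      "PiE (carrier A) V \<subseteq> U"
      unfolding openin_product_topology_alt by auto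
    let ?F = "{i \<in> carrier A. V i \<noteq> carrier M}"
    have "f y = f x" if y: "y \<in> ?X" and eq: "\<forall>u\<in>?F. y u = x u" for y
    proof -
      have yE: "y \<in> ?E" using y X_E by blast
      have "y i \<in> V i" if i: "i \<in> carrier A" for i
      proof (cases "V i = carrier M")
        case True then show ?thesis using yE i by (auto simp: PiE_iff)
      next
        case False then show ?thesis using eq V(2) i by (auto simp: PiE_iff)
      qed
      then have "y \<in> PiE (carrier A) V" using yE by (auto simp: PiE_iff)
      with U(2) V(3) y show ?thesis by blast
    qed
    with V(1) show ?thesis by (intro exI[of _ ?F]) auto
  qed
  then obtain S where S: "\<And>x. x \<in> ?X \<Longrightarrow> finite (S x)" "\<And>x. x \<in> ?X \<Longrightarrow> S x \<subseteq> carrier A"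
    "\<And>x y. x \<in> ?X \<Longrightarrow> y \<in> ?X \<Longrightarrow> (\<And>u. u \<in> S x \<Longrightarrow> y u = x u) \<Longrightarrow> f y = f x" by metis
  define cyl where "cyl x = {y \<in> ?E. \<forall>u\<in>S x. y u = x u}" for x
  have "\<exists>\<F>. finite \<F> \<and> \<F> \<subseteq> cyl ` ?X \<and> ?X \<subseteq> \<Union>\<F>"
  proof (rule compactinD[OF compactin_binar_hom[OF A fin]])
    show "openin ?P U" if U: "U \<in> cyl ` ?X" for U
    proof -
      obtain x where x: "x \<in> ?X" "U = cyl x" using U by blast
      show ?thesis unfolding x(2) cyl_def by (rule openin_cylinder[OF S(1,2)]) (use x(1) X_E in auto)
    qed
    show "?X \<subseteq> \<Union>(cyl ` ?X)" using X_E by (auto simp: cyl_def)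
  qed
  then obtain Y where Y: "finite Y" "Y \<subseteq> ?X" "?X \<subseteq> \<Union>(cyl ` Y)"
    by (metis finite_subset_image)
  let ?F = "\<Union>(S ` Y)"
  have "f x = f y" if x: "x \<in> ?X" and y: "y \<in> ?X" and eq: "\<forall>u\<in>?F. x u = y u" for x y
  proof -
    obtain x0 where x0: "x0 \<in> Y" "x \<in> cyl x0" using x Y(3) by blast
    have "f x = f x0" by (rule S(3)) (use x0 x Y(2) in \<open>auto simp: cyl_def\<close>)
    moreover have "f y = f x0"
    proof (rule S(3))
      show "y u = x0 u" if "u \<in> S x0" for u
      proof -
        have "x u = y u" using eq x0(1) that by blast
        moreover have "x u = x0 u" using x0(2) that by (simp add: cyl_def)
        ultimately show ?thesis by simp
      qed
    qed (use x0 y Y(2) in auto)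
    ultimately show ?thesis by simp
  qed
  moreover have "finite ?F" "?F \<subseteq> carrier A" using S(1,2) Y(1,2) by blast+
  ultimately show ?thesis by blast
qed

text \<open>The tuples of values of finitely many homomorphisms at a common element form a compatible
  relation, and every tuple of values of \<open>f\<close> must be one of them.\<close>

lemma preserving_imp_local_evaluation:
  assumes A: "binar_algebra A"
    and pres: "\<And>k R. compatible_rel M k R \<Longrightarrow> preserves_rel A M k R f"
    and Y: "finite Y" "Y \<subseteq> binar_hom A M" "Y \<noteq> {}"
  shows "\<exists>a\<in>carrier A. \<forall>x\<in>Y. f x = x a"
proof -
  obtain xs where xs: "set xs = Y" using finite_list[OF Y(1)] by blast
  let ?k = "length xs"
  define R where "R = (\<lambda>a. \<lambda>i\<in>{..<?k}. (xs ! i) a) ` carrier A"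
  have xsX: "xs ! i \<in> binar_hom A M" if "i < ?k" for i using that xs Y(2) nth_mem by blast
  have "compatible_rel M ?k R"
    unfolding compatible_rel_def subuniverse_def
  proof (intro conjI ballI)
    show "1 \<le> ?k" using Y(3) xs by (cases xs) auto
    show "R \<subseteq> carrier (binar_power M {..<?k})"
      using xsX unfolding R_def binar_power_def binar_hom_def by fastforce
    fix r s assume "r \<in> R" "s \<in> R"
    then obtain a b where ab: "a \<in> carrier A" "b \<in> carrier A"
      "r = (\<lambda>i\<in>{..<?k}. (xs ! i) a)" "s = (\<lambda>i\<in>{..<?k}. (xs ! i) b)" by (auto simp: R_def)
    then have "opr (binar_power M {..<?k}) r s = (\<lambda>i\<in>{..<?k}. (xs ! i) (opr A a b))"
      using xsX by (auto simp: binar_power_def binar_hom_def intro!: restrict_ext)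
    moreover have "opr A a b \<in> carrier A" using A ab by (auto simp: binar_algebra_def)
    ultimately show "opr (binar_power M {..<?k}) r s \<in> R" unfolding R_def by blast
  qed
  moreover have "(\<lambda>i\<in>{..<?k}. xs ! i) \<in> rel_pointwise A M ?k R"
    using xsX by (auto simp: rel_pointwise_def R_def intro!: image_eqI restrict_ext)
  ultimately have "(\<lambda>i\<in>{..<?k}. f ((\<lambda>i\<in>{..<?k}. xs ! i) i)) \<in> R"
    using pres unfolding preserves_rel_def by blast
  then obtain a where a: "a \<in> carrier A"
    "(\<lambda>i\<in>{..<?k}. f ((\<lambda>i\<in>{..<?k}. xs ! i) i)) = (\<lambda>i\<in>{..<?k}. (xs ! i) a)"
    unfolding R_def by blast
  have "f x = x a" if "x \<in> Y" for x
  proof -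
    obtain i where i: "i < ?k" "x = xs ! i" using \<open>x \<in> Y\<close> xs by (metis in_set_conv_nth)
    then show ?thesis using fun_cong[OF a(2), of i] by simp
  qed
  with a(1) show ?thesis by blast
qed

text \<open>The projections of a power, composed with the embedding of \<open>A\<close>, are homomorphisms.\<close>

lemma in_ISP_homs_separate:
  assumes ISP: "in_ISP TYPE('i) A M" and ab: "a \<in> carrier A" "b \<in> carrier A"
    and eq: "\<And>x. x \<in> binar_hom A M \<Longrightarrow> x a = x b"
  shows "a = b"
proof -
  obtain I :: "'i set" and B h where B: "B \<subseteq> I \<rightarrow>\<^sub>E carrier M"
    and h: "h \<in> binar_iso A ((binar_power M I)\<lparr>carrier := B\<rparr>)"
    using ISP unfolding in_ISP_def subuniverse_def by (auto simp: binar_power_def)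
  have hB: "h c \<in> B" if "c \<in> carrier A" for c
    using h that by (auto simp: binar_iso_def binar_hom_def)
  have h_mul: "h (opr A c d) = (\<lambda>i\<in>I. opr M (h c i) (h d i))" if "c \<in> carrier A" "d \<in> carrier A" for c d
    using h that by (auto simp: binar_iso_def binar_hom_def binar_power_def)
  have closed: "opr A c d \<in> carrier A" if "c \<in> carrier A" "d \<in> carrier A" for c d
    using ISP that by (auto simp: in_ISP_def binar_algebra_def)
  have proj: "(\<lambda>c\<in>carrier A. h c i) \<in> binar_hom A M" if i: "i \<in> I" for i
    using i hB B closed h_mul by (auto simp: binar_hom_def PiE_iff subset_iff)
  have "h a = h b"
  proof (rule PiE_ext)
    show "h a \<in> I \<rightarrow>\<^sub>E carrier M" "h b \<in> I \<rightarrow>\<^sub>E carrier M" using hB ab B by blast+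
    show "h a i = h b i" if "i \<in> I" for i using eq[OF proj[OF that]] ab by simp
  qed
  moreover have "inj_on h (carrier A)" using h by (auto simp: binar_iso_def bij_betw_def)
  ultimately show ?thesis using ab by (auto dest: inj_onD)
qed

section \<open>Dualizability\<close>

theorem corollary5p4:
  fixes Q \<Sigma> :: "'a set" and z :: 'a and \<delta> :: "'a \<Rightarrow> 'a \<rightharpoonup> 'a"
  assumes "partial_automaton Q \<Sigma> z \<delta>"
    and "finite Q" and "finite \<Sigma>"
    and "acts_as_abelian_permutation_group Q \<Sigma> \<delta>"
  shows "dualizable TYPE('b) TYPE('i) (automatic_algebra Q \<Sigma> z \<delta>)"
proof -
  interpret abelian_automaton Q \<Sigma> z \<delta> by (unfold_locales) (rule assms)+
  have "is_evaluation A M f"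
    if ISP: "in_ISP TYPE('i) A M"
      and cont: "continuous_map (hom_topology A M) (discrete_topology (carrier M)) f"
      and pres: "\<And>k R. compatible_rel M k R \<Longrightarrow> preserves_rel A M k R f" for A :: "'b binar" and f
  proof -
    have A: "binar_algebra A" using ISP by (simp add: in_ISP_def)
    interpret separated_algebra Q \<Sigma> z \<delta> A
    proof unfold_locales
      show "opr A a b \<in> carrier A" if "a \<in> carrier A" "b \<in> carrier A" for a b
        using A that by (simp add: binar_algebra_def)
      show "a = b" if "a \<in> carrier A" "b \<in> carrier A" "\<And>x. x \<in> binar_hom A M \<Longrightarrow> x a = x b" for a b
        using that by (rule in_ISP_homs_separate[OF ISP])
    qed
    have "finite (carrier M)" using finite_Q finite_\<Sigma> by (simp add: carrier_M)
    from continuous_finite_support[OF A this cont] obtain F where F: "finite F" "F \<subseteq> carrier A"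
      "\<forall>x\<in>X. \<forall>y\<in>X. (\<forall>u\<in>F. x u = y u) \<longrightarrow> f x = f y" by blast
    \<comment> \<open>Adding the zero homomorphism makes the set nonempty, as relations have positive arity.\<close>
    have zero: "(\<lambda>a\<in>carrier A. z) \<in> X"
      by (rule homI) (auto simp: carrier_M mul_z disjoint)
    have local: "\<exists>a\<in>carrier A. \<forall>x\<in>Y. f x = x a" if "finite Y" "Y \<subseteq> X" for Y
      using preserving_imp_local_evaluation[OF A pres, of "insert (\<lambda>a\<in>carrier A. z) Y"] zero that by auto
    interpret local_evaluation Q \<Sigma> z \<delta> A f F
    proof unfold_locales
      show "f x = f y" if "x \<in> X" "y \<in> X" "\<And>u. u \<in> F \<Longrightarrow> x u = y u" for x y
        using F(3) that by blast
      show "\<exists>a\<in>carrier A. \<forall>x\<in>Y. f x = x a" if "finite Y" "Y \<subseteq> X" for Y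
        using that by (rule local)
    qed (fact F(1) F(2))+
    have "\<exists>a\<in>carrier A. \<forall>x\<in>X. f x = x a"
    proof (cases "f (chi irreducibles) = z \<and> (\<exists>x\<in>X. f x \<in> Q)")
      case True
      then interpret state_valued Q \<Sigma> z \<delta> A f F by unfold_locales blast+
      obtain a where a: "a \<in> carrier A"
        "\<exists>b\<in>carrier A. \<exists>vs. vs \<noteq> [] \<and> set vs \<subseteq> carrier A \<and> a = act A b vs"
        "\<forall>x\<in>X. f x \<in> Q \<longleftrightarrow> x a \<in> Q" using principal_support by blast
      interpret principal Q \<Sigma> z \<delta> A f F a by unfold_locales (use a in blast)+
      show ?thesis by (rule evaluation_at_word)
    next
      case False
      then show ?thesis using evaluation_at_irreducible evaluation_at_zero by blast
    qed
    then show ?thesis by (simp add: is_evaluation_def)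
  qed
  then show ?thesis unfolding dualizable_def by blast
qed

end
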